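(* Let $S$ be a set of $n$ points with integer coordinates on the $y$-axis, let $G$ be a perfect matching consisting of $n/2$ edges (on $n$ vertices), and let $\mu$ be a bijection from the vertex set of $G$ to $S$. A $\mu$-respecting restricted RAC$_2$ drawing of $G$ lying in the closed half-plane $\{x \ge 0\}$ (to the right of the $y$-axis) that has minimum area among all such drawings can be computed in $O(n^2)$ time.
   Context: A $\mu$-respecting drawing places each vertex $v$ at $\mu(v)$ and draws each edge $uv$ as a polygonal chain from $\mu(u)$ to $\mu(v)$; edges may not overlap (share a segment of positive length) and may not pass through points representing other vertices. It is restricted RAC$_2$ if every bend lies on a point with integer coordinates, every edge segment is horizontal or vertical (lies on a grid line), every edge has at most two bends, and any two crossing edges cross at a right angle. The area of a drawing is the area of its bounding box on the integer grid. *)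

theory Defs
  imports "HOL-Analysis.Analysis" "HOL-Library.Landau_Symbols"
begin

definition perfect_matching :: "'v set \<Rightarrow> 'v set set \<Rightarrow> bool" where
  "perfect_matching V E \<longleftrightarrow>
     (\<forall>e\<in>E. e \<subseteq> V \<and> card e = 2) \<and> (\<forall>v\<in>V. \<exists>!e. e \<in> E \<and> v \<in> e)"

type_synonym point = "real \<times> real"

text \<open>A polygonal chain is given by the list of its corners; the first and the last one are
  its end points, all the others are its bends.\<close>

definition segments :: "point list \<Rightarrow> (point \<times> point) list" where
  "segments c = zip (butlast c) (tl c)"

definition bends :: "point list \<Rightarrow> point list" where
  "bends c = butlast (tl c)"

definition curve :: "point list \<Rightarrow> point set" where
  "curve c = (\<Union>(p, q)\<in>set (segments c). closed_segment p q)"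

definition overlap :: "point set \<Rightarrow> point set \<Rightarrow> bool" where
  "overlap A B \<longleftrightarrow> (\<exists>p q. p \<noteq> q \<and> closed_segment p q \<subseteq> A \<inter> B)"

text \<open>The last conjunct excludes chains that run back over themselves.\<close>

definition polygonal_chain :: "point list \<Rightarrow> bool" where
  "polygonal_chain c \<longleftrightarrow>
     2 \<le> length c \<and>
     (\<forall>(p, q)\<in>set (segments c). p \<noteq> q) \<and>
     (\<forall>i j. i < j \<and> j < length (segments c) \<longrightarrow>
        \<not> overlap (closed_segment (fst (segments c ! i)) (snd (segments c ! i)))
                  (closed_segment (fst (segments c ! j)) (snd (segments c ! j))))"

definition respecting_drawing ::
  "'v set \<Rightarrow> 'v set set \<Rightarrow> ('v \<Rightarrow> point) \<Rightarrow> ('v set \<Rightarrow> point list) \<Rightarrow> bool" where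
  "respecting_drawing V E \<mu> D \<longleftrightarrow>
     (\<forall>e\<in>E. polygonal_chain (D e) \<and>
        (\<exists>u v. e = {u, v} \<and> hd (D e) = \<mu> u \<and> last (D e) = \<mu> v)) \<and>
     (\<forall>e\<in>E. \<forall>f\<in>E. e \<noteq> f \<longrightarrow> \<not> overlap (curve (D e)) (curve (D f))) \<and>
     (\<forall>e\<in>E. \<forall>v\<in>V. v \<notin> e \<longrightarrow> \<mu> v \<notin> curve (D e))"

definition integer_point :: "point \<Rightarrow> bool" where
  "integer_point p \<longleftrightarrow> fst p \<in> \<int> \<and> snd p \<in> \<int>"

definition on_grid_line :: "point \<Rightarrow> point \<Rightarrow> bool" where
  "on_grid_line p q \<longleftrightarrow> fst p = fst q \<and> fst p \<in> \<int> \<or> snd p = snd q \<and> snd p \<in> \<int>"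

definition restricted_RAC2 :: "'v set set \<Rightarrow> ('v set \<Rightarrow> point list) \<Rightarrow> bool" where
  "restricted_RAC2 E D \<longleftrightarrow>
     (\<forall>e\<in>E. length (bends (D e)) \<le> 2 \<and>
        (\<forall>b\<in>set (bends (D e)). integer_point b) \<and>
        (\<forall>(p, q)\<in>set (segments (D e)). on_grid_line p q)) \<and>
     (\<forall>e\<in>E. \<forall>f\<in>E. e \<noteq> f \<longrightarrow>
        (\<forall>(a, b)\<in>set (segments (D e)). \<forall>(c, d)\<in>set (segments (D f)).
           open_segment a b \<inter> open_segment c d \<noteq> {} \<longrightarrow> orthogonal (b - a) (d - c)))"

definition drawing_points ::
  "'v set \<Rightarrow> 'v set set \<Rightarrow> ('v \<Rightarrow> point) \<Rightarrow> ('v set \<Rightarrow> point list) \<Rightarrow> point set" where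
  "drawing_points V E \<mu> D = \<mu> ` V \<union> (\<Union>e\<in>E. curve (D e))"

definition bounding_box :: "point set \<Rightarrow> point set" where
  "bounding_box X = \<Inter> {cbox a b | a b. X \<subseteq> cbox a b}"

definition drawing_area ::
  "'v set \<Rightarrow> 'v set set \<Rightarrow> ('v \<Rightarrow> point) \<Rightarrow> ('v set \<Rightarrow> point list) \<Rightarrow> real" where
  "drawing_area V E \<mu> D = measure lborel (bounding_box (drawing_points V E \<mu> D))"

definition right_RAC2_drawing ::
  "'v set \<Rightarrow> 'v set set \<Rightarrow> ('v \<Rightarrow> point) \<Rightarrow> ('v set \<Rightarrow> point list) \<Rightarrow> bool" where
  "right_RAC2_drawing V E \<mu> D \<longleftrightarrow>
     respecting_drawing V E \<mu> D \<and> restricted_RAC2 E D \<and>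
     drawing_points V E \<mu> D \<subseteq> {p. 0 \<le> fst p}"

definition min_area_right_RAC2_drawing ::
  "'v set \<Rightarrow> 'v set set \<Rightarrow> ('v \<Rightarrow> point) \<Rightarrow> ('v set \<Rightarrow> point list) \<Rightarrow> bool" where
  "min_area_right_RAC2_drawing V E \<mu> D \<longleftrightarrow>
     right_RAC2_drawing V E \<mu> D \<and>
     (\<forall>D'. right_RAC2_drawing V E \<mu> D' \<longrightarrow> drawing_area V E \<mu> D \<le> drawing_area V E \<mu> D')"

text \<open>The instruction set of Cook and Reckhow: registers \<open>X\<^sub>0, X\<^sub>1, \<dots>\<close> hold integers, and the only
  arithmetic operations are addition and subtraction. In this order, the instructions are
  \<open>X\<^sub>i \<leftarrow> c\<close>, \<open>X\<^sub>i \<leftarrow> X\<^sub>j + X\<^sub>k\<close>, \<open>X\<^sub>i \<leftarrow> X\<^sub>j - X\<^sub>k\<close>, \<open>X\<^sub>i \<leftarrow> X\<^bsub>X\<^sub>j\<^esub>\<close>, \<open>X\<^bsub>X\<^sub>i\<^esub> \<leftarrow> X\<^sub>j\<close>,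
  ``go to instruction \<open>l\<close> if \<open>X\<^sub>j > 0\<close>'', ``read \<open>X\<^sub>i\<close>'' and ``print \<open>X\<^sub>i\<close>''.\<close>

datatype instr =
    Const nat int
  | Add nat nat nat
  | Sub nat nat nat
  | Load nat nat
  | Store nat nat
  | JumpPos nat nat
  | Read nat
  | Print nat

record ram_state =
  pc :: nat
  reg :: "nat \<Rightarrow> int"
  in_tape :: "int list"
  out_tape :: "int list"

text \<open>A negative address in an indirect access refers to register 0, and reading from an
  exhausted input yields 0.\<close>

fun exec :: "instr \<Rightarrow> ram_state \<Rightarrow> ram_state" where
  "exec (Const i c) s = s\<lparr>pc := pc s + 1, reg := (reg s)(i := c)\<rparr>"
| "exec (Add i j k) s = s\<lparr>pc := pc s + 1, reg := (reg s)(i := reg s j + reg s k)\<rparr>"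
| "exec (Sub i j k) s = s\<lparr>pc := pc s + 1, reg := (reg s)(i := reg s j - reg s k)\<rparr>"
| "exec (Load i j) s = s\<lparr>pc := pc s + 1, reg := (reg s)(i := reg s (nat (reg s j)))\<rparr>"
| "exec (Store i j) s = s\<lparr>pc := pc s + 1, reg := (reg s)(nat (reg s i) := reg s j)\<rparr>"
| "exec (JumpPos l j) s = s\<lparr>pc := (if reg s j > 0 then l else pc s + 1)\<rparr>"
| "exec (Read i) s =
     s\<lparr>pc := pc s + 1,
       reg := (reg s)(i := (case in_tape s of [] \<Rightarrow> 0 | x # _ \<Rightarrow> x)), in_tape := tl (in_tape s)\<rparr>"
| "exec (Print i) s = s\<lparr>pc := pc s + 1, out_tape := out_tape s @ [reg s i]\<rparr>"

text \<open>The machine halts by leaving the program; a halted machine does not change any more.\<close>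

definition step :: "instr list \<Rightarrow> ram_state \<Rightarrow> ram_state" where
  "step P s = (if pc s < length P then exec (P ! pc s) s else s)"

definition init_state :: "int list \<Rightarrow> ram_state" where
  "init_state xs = \<lparr>pc = 0, reg = (\<lambda>_. 0), in_tape = xs, out_tape = []\<rparr>"

definition computes_within :: "instr list \<Rightarrow> int list \<Rightarrow> int list \<Rightarrow> nat \<Rightarrow> bool" where
  "computes_within P xs ys t \<longleftrightarrow>
     (\<exists>k\<le>t. let s = (step P ^^ k) (init_state xs) in length P \<le> pc s \<and> out_tape s = ys)"

text \<open>The vertices are \<open>0, \<dots>, n - 1\<close>, and the edges are listed in an arbitrary order, each one as
  a pair of its end vertices in arbitrary order.\<close>

definition lists_edges :: "(nat \<times> nat) list \<Rightarrow> nat set set \<Rightarrow> bool" where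
  "lists_edges es E \<longleftrightarrow>
     distinct (map (\<lambda>(u, v). {u, v}) es) \<and> set (map (\<lambda>(u, v). {u, v}) es) = E"

text \<open>Rounding in the encodings below loses nothing: all corners of a restricted RAC drawing whose
  vertices are integer points are integer points themselves. The number of corners in front
  of each chain makes the encoding of a drawing uniquely decodable.\<close>

definition encode_instance :: "nat \<Rightarrow> (nat \<Rightarrow> point) \<Rightarrow> (nat \<times> nat) list \<Rightarrow> int list" where
  "encode_instance n \<mu> es =
     int n # map (\<lambda>v. \<lfloor>snd (\<mu> v)\<rfloor>) [0..<n] @ concat (map (\<lambda>(u, v). [int u, int v]) es)"

definition encode_chain :: "point list \<Rightarrow> int list" where
  "encode_chain c = int (length c) # concat (map (\<lambda>p. [\<lfloor>fst p\<rfloor>, \<lfloor>snd p\<rfloor>]) c)"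

definition encode_drawing :: "(nat set \<Rightarrow> point list) \<Rightarrow> (nat \<times> nat) list \<Rightarrow> int list" where
  "encode_drawing D es = concat (map (\<lambda>(u, v). encode_chain (D {u, v})) es)"

end

theory Submission imports Defs begin

text \<open>With at most two bends and all segments on grid lines, an edge between two points of the
  \<open>y\<close>-axis is either a straight piece of the axis, which is possible only for consecutive points, or
  consists of two horizontal segments joined by a vertical one at some integer \<open>x \<ge> 1\<close>. Horizontal
  segments of different edges lie at different heights, so the only constraint left is that the vertical
  segments on one line are disjoint. The height of the bounding box is fixed; hence minimising the area
  is colouring the intervals spanned by the non-consecutive edges with as few colours as
  possible. Sweeping the points upwards and taking the first free colour for each interval is optimal,
  because colour \<open>c\<close> is used only where \<open>c\<close> intervals have a common point. Computing the rank of each point by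
  comparing it with all others and searching the free colour linearly costs \<open>O(n)\<close> per point.\<close>

section \<open>Structured programs on the register machine\<close>

text \<open>The lower bound does not rest on a normal form for arbitrary drawings. From each edge it
  extracts only a vertical copy, at some natural abscissa, of the interval between the heights of
  its ends. This treats all degenerate chains at once, and the vertical extent of a competitor needs
  no control because its box contains all vertices anyway. Track 0 is the y-axis itself, so one
  formula draws the edges between consecutive points and all others. Optimality and execution are
  kept apart: \<open>sweep\<close> is a function on positions, and the machine is shown to tabulate
  it. Since the step count is part of the claim and jumps depend on a positive register, programs
  are written in a small structured language whose rules carry time budgets.\<close>

datatype com = Block "instr list" | Seq com com (infixr ";;" 60) | Unless nat com | DoWhile com nat

fun csize :: "com \<Rightarrow> nat" where
  "csize (Block is) = length is"
| "csize (c ;; d) = csize c + csize d"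
| "csize (Unless j c) = Suc (csize c)"
| "csize (DoWhile c j) = Suc (csize c)"

text \<open>Jump targets are absolute, so \<open>a\<close> is the address where the code will lie. A
  positive register skips the body of \<open>Unless\<close> and repeats the body of
  \<open>DoWhile\<close>. Each construct costs a single instruction, at the price that a loop body
  always runs at least once.\<close>

fun compile :: "nat \<Rightarrow> com \<Rightarrow> instr list" where
  "compile a (Block is) = is"
| "compile a (c ;; d) = compile a c @ compile (a + csize c) d"
| "compile a (Unless j c) = JumpPos (Suc a + csize c) j # compile (Suc a) c"
| "compile a (DoWhile c j) = compile a c @ [JumpPos a j]"

lemma length_compile [simp]: "length (compile a c) = csize c"
  by (induction c arbitrary: a) auto

section \<open>Total correctness with step budgets\<close>

type_synonym assertion = "(nat \<Rightarrow> int) \<Rightarrow> int list \<Rightarrow> int list \<Rightarrow> bool"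

fun holds :: "assertion \<Rightarrow> ram_state \<Rightarrow> bool" where
  "holds \<Phi> s = \<Phi> (reg s) (in_tape s) (out_tape s)"

definition code_at :: "instr list \<Rightarrow> nat \<Rightarrow> instr list \<Rightarrow> bool" where
  "code_at P a c \<longleftrightarrow> a + length c \<le> length P \<and> (\<forall>i<length c. P ! (a + i) = c ! i)"

lemma code_at_append:
  "code_at P a (c @ d) \<longleftrightarrow> code_at P a c \<and> code_at P (a + length c) d"
  (is "?L \<longleftrightarrow> ?R")
proof
  assume L: ?L
  have "P ! (a + length c + i) = d ! i" if "i < length d" for i
  proof -
    have "P ! (a + (length c + i)) = (c @ d) ! (length c + i)"
      using L that unfolding code_at_def by simp
    then show ?thesis by (simp add: add.assoc)
  qed
  moreover have "P ! (a + i) = c ! i" if "i < length c" for i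
    using L that unfolding code_at_def by (auto simp: nth_append dest: spec[of _ i])
  ultimately show ?R using L unfolding code_at_def by auto
next
  assume R: ?R
  have "P ! (a + i) = (c @ d) ! i" if "i < length c + length d" for i
  proof (cases "i < length c")
    case True
    then show ?thesis using R unfolding code_at_def by (auto simp: nth_append)
  next
    case False
    moreover from this have "i - length c < length d" using that by linarith
    ultimately have "P ! (a + length c + (i - length c)) = d ! (i - length c)"
      using R unfolding code_at_def by blast
    then show ?thesis using False by (simp add: nth_append)
  qed
  then show ?L using R unfolding code_at_def by auto
qed

lemma code_at_single: "code_at P a [i] \<longleftrightarrow> a < length P \<and> P ! a = i"
  unfolding code_at_def by auto

lemma code_at_Cons:
  "code_at P a (i # c) \<longleftrightarrow> a < length P \<and> P ! a = i \<and> code_at P (Suc a) c"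
  using code_at_append[of P a "[i]" c] by (simp add: code_at_single)

text \<open>Bounding \<open>t\<close> by \<open>T\<close> instead of fixing it lets branches of
  different length share one budget. Quantifying over \<open>P\<close> and \<open>a\<close> makes
  the assertion independent of the surrounding program.\<close>

definition wp :: "com \<Rightarrow> nat \<Rightarrow> assertion \<Rightarrow> assertion" where
  "wp c T \<Phi> R i out \<longleftrightarrow>
     (\<forall>P a s. code_at P a (compile a c) \<and> pc s = a \<and> reg s = R \<and> in_tape s = i \<and> out_tape s = out \<longrightarrow>
        (\<exists>t\<le>T. pc ((step P ^^ t) s) = a + csize c \<and> holds \<Phi> ((step P ^^ t) s)))"

lemma wp_mono:
  assumes "wp c T \<Phi> R i out" "T \<le> T'" "\<And>R i out. \<Phi> R i out \<Longrightarrow> \<Psi> R i out"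
  shows "wp c T' \<Psi> R i out"
  unfolding wp_def
proof (intro allI impI)
  fix P a and s :: ram_state
  assume "code_at P a (compile a c) \<and> pc s = a \<and> reg s = R \<and> in_tape s = i \<and> out_tape s = out"
  then obtain t where "t \<le> T" "pc ((step P ^^ t) s) = a + csize c" "holds \<Phi> ((step P ^^ t) s)"
    using assms(1) unfolding wp_def by blast
  then show "\<exists>t\<le>T'. pc ((step P ^^ t) s) = a + csize c \<and> holds \<Psi> ((step P ^^ t) s)"
    using assms(2,3) by (intro exI[of _ t]) auto
qed

lemma wp_Seq:
  assumes "wp c T1 (wp d T2 \<Phi>) R i out"
  shows "wp (c ;; d) (T1 + T2) \<Phi> R i out"
  unfolding wp_def
proof (intro allI impI, elim conjE)
  fix P a and s :: ram_state
  assume c: "code_at P a (compile a (c ;; d))" and s: "pc s = a" "reg s = R" "in_tape s = i" "out_tape s = out"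
  then have c1: "code_at P a (compile a c)" and c2: "code_at P (a + csize c) (compile (a + csize c) d)"
    by (auto simp: code_at_append)
  obtain t1 where t1: "t1 \<le> T1" "pc ((step P ^^ t1) s) = a + csize c" "holds (wp d T2 \<Phi>) ((step P ^^ t1) s)"
    using assms c1 s unfolding wp_def[of c] by blast
  then obtain t2 where t2: "t2 \<le> T2" "pc ((step P ^^ t2) ((step P ^^ t1) s)) = a + csize c + csize d"
     "holds \<Phi> ((step P ^^ t2) ((step P ^^ t1) s))"
    using c2 unfolding holds.simps wp_def[of d] by blast
  show "\<exists>t\<le>T1 + T2. pc ((step P ^^ t) s) = a + csize (c ;; d) \<and> holds \<Phi> ((step P ^^ t) s)"
    using t1 t2 by (intro exI[of _ "t2 + t1"]) (auto simp: funpow_add)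
qed

lemma wp_SeqI:
  assumes "wp c T1 \<Psi> R i out" "\<And>R i out. \<Psi> R i out \<Longrightarrow> wp d T2 \<Phi> R i out"
  shows "wp (c ;; d) (T1 + T2) \<Phi> R i out"
  by (rule wp_Seq, rule wp_mono[OF assms(1)]) (use assms(2) in auto)

lemma wp_Unless:
  assumes "R j \<le> 0 \<Longrightarrow> wp c T \<Phi> R i out" "0 < R j \<Longrightarrow> \<Phi> R i out"
  shows "wp (Unless j c) (Suc T) \<Phi> R i out"
  unfolding wp_def
proof (intro allI impI, elim conjE)
  fix P a and s :: ram_state
  assume c: "code_at P a (compile a (Unless j c))" and s: "pc s = a" "reg s = R" "in_tape s = i" "out_tape s = out"
  then have P: "a < length P" "P ! a = JumpPos (Suc a + csize c) j" and c1: "code_at P (Suc a) (compile (Suc a) c)"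
    by (auto simp: code_at_Cons)
  show "\<exists>t\<le>Suc T. pc ((step P ^^ t) s) = a + csize (Unless j c) \<and> holds \<Phi> ((step P ^^ t) s)"
  proof (cases "0 < R j")
    case True
    then show ?thesis using assms(2) P s by (intro exI[of _ 1]) (auto simp: step_def)
  next
    case False
    then have w: "wp c T \<Phi> R i out" using assms(1) by simp
    have "pc (step P s) = Suc a" "reg (step P s) = R" "in_tape (step P s) = i" "out_tape (step P s) = out"
      using False P s by (auto simp: step_def)
    then obtain t where "t \<le> T" "pc ((step P ^^ t) (step P s)) = Suc a + csize c" "holds \<Phi> ((step P ^^ t) (step P s))"
      using w c1 unfolding wp_def by blast
    then show ?thesis by (intro exI[of _ "Suc t"]) (auto simp: funpow_swap1)
  qed
qed

text \<open>The number of rounds \<open>N\<close> is known on entry to every loop, so it takes the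
  place of a variant: the invariant is indexed by the completed rounds, and the test register must
  be positive exactly while rounds remain. Each round pays one extra step for the jump.\<close>

lemma wp_DoWhile:
  assumes "I 0 R i out" "0 < N"
    and step: "\<And>k R i out. k < N \<Longrightarrow> I k R i out \<Longrightarrow>
        wp c T (\<lambda>R i out. I (Suc k) R i out \<and> (0 < R j \<longleftrightarrow> Suc k < N)) R i out"
  shows "wp (DoWhile c j) (N * Suc T) (I N) R i out"
proof -
  have *: "\<exists>t\<le>(N - k) * Suc T. pc ((step P ^^ t) s) = a + csize (DoWhile c j) \<and> holds (I N) ((step P ^^ t) s)"
    if "k < N" "holds (I k) s" "pc s = a" and c: "code_at P a (compile a (DoWhile c j))" for k s P a
    using that
  proof (induction "N - k" arbitrary: k s)
    case 0
    then show ?case by simp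
  next
    case (Suc m)
    have c1: "code_at P a (compile a c)" and P: "a + csize c < length P" "P ! (a + csize c) = JumpPos a j"
      using c by (auto simp: code_at_append code_at_single)
    obtain t where t: "t \<le> T" "pc ((step P ^^ t) s) = a + csize c"
        "I (Suc k) (reg ((step P ^^ t) s)) (in_tape ((step P ^^ t) s)) (out_tape ((step P ^^ t) s))"
        "0 < reg ((step P ^^ t) s) j \<longleftrightarrow> Suc k < N"
      using step[of k] Suc.prems c1 unfolding wp_def holds.simps by blast
    define s' where "s' = step P ((step P ^^ t) s)"
    have s': "s' = (step P ^^ Suc t) s" by (simp add: s'_def)
    have I: "holds (I (Suc k)) s'" and pc: "pc s' = (if Suc k < N then a else Suc (a + csize c))"
      using t P by (auto simp: s'_def step_def)
    show ?case
    proof (cases "Suc k < N")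
      case True
      obtain t' where "t' \<le> (N - Suc k) * Suc T" "pc ((step P ^^ t') s') = a + csize (DoWhile c j)"
        "holds (I N) ((step P ^^ t') s')"
        using Suc.hyps(1)[OF _ True I _ c] Suc.hyps(2) True pc by (metis Suc_diff_Suc Suc_inject Suc_lessD)
      moreover have "(N - k) * Suc T = Suc T + (N - Suc k) * Suc T"
        using Suc.prems(1) by (metis Suc_diff_Suc mult_Suc)
      ultimately show ?thesis using t(1) unfolding s'
        by (intro exI[of _ "t' + Suc t"]) (auto simp only: funpow_add o_apply)
    next
      case False
      then have "Suc k = N" using Suc.prems by simp
      then show ?thesis using I pc t(1) Suc.hyps(2) unfolding s'
        by (intro exI[of _ "Suc t"]) auto
    qed
  qed
  show ?thesis using *[of 0] assms(1,2) unfolding wp_def holds.simps by auto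
qed

text \<open>Symbolic execution: rewriting with these equations reduces a straight-line block to
  register updates. A jump yields \<open>False\<close> because it may leave the straight
  line.\<close>

fun run_block :: "instr list \<Rightarrow> assertion \<Rightarrow> assertion" where
  "run_block [] \<Phi> R i out = \<Phi> R i out"
| "run_block (Const x c # is) \<Phi> R i out = run_block is \<Phi> (R(x := c)) i out"
| "run_block (Add x y z # is) \<Phi> R i out = run_block is \<Phi> (R(x := R y + R z)) i out"
| "run_block (Sub x y z # is) \<Phi> R i out = run_block is \<Phi> (R(x := R y - R z)) i out"
| "run_block (Load x y # is) \<Phi> R i out = run_block is \<Phi> (R(x := R (nat (R y)))) i out"
| "run_block (Store x y # is) \<Phi> R i out = run_block is \<Phi> (R(nat (R x) := R y)) i out"
| "run_block (JumpPos l j # is) \<Phi> R i out = False"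
| "run_block (Read x # is) \<Phi> R i out =
     run_block is \<Phi> (R(x := (case i of [] \<Rightarrow> 0 | z # _ \<Rightarrow> z))) (tl i) out"
| "run_block (Print x # is) \<Phi> R i out = run_block is \<Phi> R i (out @ [R x])"

lemma wp_Block:
  assumes "run_block is \<Phi> R i out" "length is \<le> T"
  shows "wp (Block is) T \<Phi> R i out"
proof -
  have "pc ((step P ^^ length is) s) = a + length is \<and> holds \<Phi> ((step P ^^ length is) s)"
    if "code_at P a is" "pc s = a" "run_block is \<Phi> (reg s) (in_tape s) (out_tape s)" for P a s
    using that
  proof (induction "is" arbitrary: a s)
    case Nil
    then show ?case by simp
  next
    case (Cons x xs)
    then have P: "a < length P" "P ! a = x" and c: "code_at P (Suc a) xs"
      by (auto simp: code_at_Cons)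
    have "pc (step P s) = Suc a \<and> run_block xs \<Phi> (reg (step P s)) (in_tape (step P s)) (out_tape (step P s))"
      using P Cons.prems by (cases x) (auto simp: step_def)
    then show ?case using Cons.IH[OF c, of "step P s"] by (simp add: funpow_swap1)
  qed
  then show ?thesis using assms unfolding wp_def by (auto intro!: exI[of _ "length is"])
qed

lemma wp_Block_Seq:
  assumes "run_block is (wp c T2 \<Phi>) R i out" "length is \<le> T1"
  shows "wp (Block is ;; c) (T1 + T2) \<Phi> R i out"
  by (rule wp_Seq, rule wp_Block) (use assms in auto)

lemma wp_computes_within:
  assumes "wp c T (\<lambda>_ _ out. out = ys) (\<lambda>_. 0) xs []"
  shows "computes_within (compile 0 c) xs ys T"
proof -
  have "code_at (compile 0 c) 0 (compile 0 c)" by (simp add: code_at_def)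
  then have "\<exists>t\<le>T. pc ((step (compile 0 c) ^^ t) (init_state xs)) = 0 + csize c \<and>
      holds (\<lambda>_ _ out. out = ys) ((step (compile 0 c) ^^ t) (init_state xs))"
    using assms[unfolded wp_def, rule_format, of "compile 0 c" 0 "init_state xs"]
    by (simp add: init_state_def)
  then show ?thesis unfolding computes_within_def by (auto simp: Let_def)
qed

section \<open>Greedy track assignment\<close>

text \<open>\<open>sweep q k = (X, T)\<close>: after the positions \<open>1, \<dots>, k\<close> have been swept, \<open>X j\<close> is the track of the
  edge ending at position \<open>j\<close>, with \<open>0\<close> also standing for edges not reached yet, and \<open>T c\<close> is the last
  position occupied on track \<open>c\<close>, with \<open>0\<close> standing for an unused track.\<close>

fun sweep :: "(nat \<Rightarrow> nat) \<Rightarrow> nat \<Rightarrow> (nat \<Rightarrow> nat) \<times> (nat \<Rightarrow> nat)" where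
  "sweep q 0 = (\<lambda>_. 0, \<lambda>_. 0)"
| "sweep q (Suc k) =
     (let (X, T) = sweep q k; c = (LEAST c. 0 < c \<and> T c \<le> Suc k)
      in if Suc (Suc k) < q (Suc k) then (X(Suc k := c, q (Suc k) := c), T(c := q (Suc k))) else (X, T))"

lemma sweep_unused: "k < c \<Longrightarrow> snd (sweep q k) c = 0"
proof (induction k arbitrary: c)
  case (Suc k)
  obtain X T where s: "sweep q k = (X, T)" by fastforce
  have "T (Suc k) = 0" using Suc.IH[of "Suc k"] s by simp
  then have "(LEAST c. 0 < c \<and> T c \<le> Suc k) \<le> Suc k" by (intro Least_le) simp
  moreover have "T c = 0" using Suc s by simp
  ultimately show ?case using Suc.prems by (auto simp: s Let_def)
qed simp

text \<open>Singles out the lower ends of the edges that do not fit on the y-axis.\<close>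

definition long_at :: "(nat \<Rightarrow> nat) \<Rightarrow> nat \<Rightarrow> bool" where
  "long_at q j \<longleftrightarrow> 0 < j \<and> Suc j < q j"

locale involution =
  fixes q :: "nat \<Rightarrow> nat" and n :: nat
  assumes q_range: "j \<in> {1..n} \<Longrightarrow> q j \<in> {1..n}"
    and q_q: "j \<in> {1..n} \<Longrightarrow> q (q j) = j"
begin

lemma q_inj: "i \<in> {1..n} \<Longrightarrow> j \<in> {1..n} \<Longrightarrow> q i = q j \<Longrightarrow> i = j"
  using q_q by metis

text \<open>The first two clauses say which entries of \<open>X\<close> are set and that both ends
  of an edge agree. The next two tie \<open>T c\<close> to the topmost end on track
  \<open>c\<close>. The fifth says that the colouring is proper. The last one is the reason for
  optimality: every smaller track was blocked by an edge reaching beyond \<open>j\<close>.\<close>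

definition sweep_inv :: "nat \<Rightarrow> (nat \<Rightarrow> nat) \<times> (nat \<Rightarrow> nat) \<Rightarrow> bool" where
  "sweep_inv k = (\<lambda>(X, T).
     (\<forall>j\<in>{1..n}. X j = 0 \<longleftrightarrow> \<not> (long_at q j \<and> j \<le> k \<or> long_at q (q j) \<and> q j \<le> k)) \<and>
     (\<forall>j\<in>{1..n}. X (q j) = X j) \<and>
     (\<forall>j\<in>{1..k}. long_at q j \<longrightarrow> q j \<le> T (X j)) \<and>
     (\<forall>c>0. T c \<noteq> 0 \<longrightarrow> (\<exists>j\<in>{1..k}. long_at q j \<and> X j = c \<and> q j = T c)) \<and>
     (\<forall>j\<in>{1..k}. \<forall>i\<in>{1..<j}. long_at q i \<longrightarrow> long_at q j \<longrightarrow> X i = X j \<longrightarrow> q i < j) \<and>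
     (\<forall>j\<in>{1..k}. long_at q j \<longrightarrow> (\<forall>c\<in>{1..<X j}. \<exists>i\<in>{1..<j}. long_at q i \<and> X i = c \<and> j < q i)))"

lemma sweep_inv_step:
  assumes "sweep_inv k (sweep q k)" "Suc k \<le> n"
  shows "sweep_inv (Suc k) (sweep q (Suc k))"
proof -
  obtain X T where s: "sweep q k = (X, T)" by fastforce
  have Xz: "\<And>j. j \<in> {1..n} \<Longrightarrow> X j = 0 \<longleftrightarrow> \<not> (long_at q j \<and> j \<le> k \<or> long_at q (q j) \<and> q j \<le> k)"
    and Xq: "\<And>j. j \<in> {1..n} \<Longrightarrow> X (q j) = X j"
    and Tge: "\<And>j. j \<in> {1..k} \<Longrightarrow> long_at q j \<Longrightarrow> q j \<le> T (X j)"
    and Tex: "\<And>c. c > 0 \<Longrightarrow> T c \<noteq> 0 \<Longrightarrow> \<exists>j\<in>{1..k}. long_at q j \<and> X j = c \<and> q j = T c"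
    and dis: "\<And>i j. j \<in> {1..k} \<Longrightarrow> i \<in> {1..<j} \<Longrightarrow> long_at q i \<Longrightarrow> long_at q j \<Longrightarrow> X i = X j \<Longrightarrow> q i < j"
    and low: "\<And>j c. j \<in> {1..k} \<Longrightarrow> long_at q j \<Longrightarrow> c \<in> {1..<X j} \<Longrightarrow> \<exists>i\<in>{1..<j}. long_at q i \<and> X i = c \<and> j < q i"
    using assms(1) unfolding s sweep_inv_def by auto
  define K where "K = Suc k"
  have K: "K \<in> {1..n}" using assms(2) by (simp add: K_def)
  show ?thesis
  proof (cases "Suc K < q K")
    case False
    then have nl: "\<not> long_at q K" by (simp add: long_at_def)
    have s': "sweep q (Suc k) = (X, T)" using False by (simp add: s Let_def K_def)
    have le: "j \<le> Suc k \<and> long_at q j \<longleftrightarrow> j \<le> k \<and> long_at q j" for j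
      using nl by (auto simp: K_def le_Suc_eq)
    show ?thesis unfolding s' sweep_inv_def prod.case
    proof (intro conjI ballI allI impI)
      fix j assume "j \<in> {1..n}"
      then show "X j = 0 \<longleftrightarrow> \<not> (long_at q j \<and> j \<le> Suc k \<or> long_at q (q j) \<and> q j \<le> Suc k)"
        using Xz[of j] le by blast
    next
      fix j assume j: "j \<in> {1..Suc k}" "long_at q j"
      then have jk: "j \<in> {1..k}" using le by auto
      show "q j \<le> T (X j)" using Tge[OF jk j(2)] .
      show "\<exists>i\<in>{1..<j}. long_at q i \<and> X i = c \<and> j < q i" if "c \<in> {1..<X j}" for c
        using low[OF jk j(2) that] .
    next
      fix i j assume "j \<in> {1..Suc k}" "i \<in> {1..<j}" "long_at q i" "long_at q j" "X i = X j"
      then show "q i < j" using dis[of j i] le by auto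
    next
      fix c :: nat assume "0 < c" "T c \<noteq> 0"
      then show "\<exists>j\<in>{1..Suc k}. long_at q j \<and> X j = c \<and> q j = T c" using Tex[of c] by force
    qed (use Xq in auto)
  next
    case True
    then have lK: "long_at q K" by (simp add: long_at_def K_def)
    define c where "c = (LEAST c. 0 < c \<and> T c \<le> K)"
    have "\<exists>c. 0 < c \<and> T c \<le> K" using sweep_unused[of k K q] s by (intro exI[of _ K]) (auto simp: K_def)
    then have c: "0 < c" "T c \<le> K" unfolding c_def by (metis (mono_tags, lifting) LeastI_ex)+
    have cmin: "K < T c'" if "0 < c'" "c' < c" for c'
      using not_less_Least[of c' "\<lambda>c. 0 < c \<and> T c \<le> K"] that unfolding c_def by auto
    define X' where "X' = X(K := c, q K := c)"
    define T' where "T' = T(c := q K)"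
    have s': "sweep q (Suc k) = (X', T')" using True by (simp add: s Let_def K_def X'_def T'_def c_def)
    have qKn: "q K \<in> {1..n}" "q (q K) = K" using q_range[OF K] q_q[OF K] .
    have nlq: "\<not> long_at q (q K)" using qKn True by (simp add: long_at_def)
    have X'eq: "X' j = X j" if "j \<noteq> K" "j \<noteq> q K" for j using that by (simp add: X'_def)
    have X'K: "X' K = c" "X' (q K) = c" by (auto simp: X'_def)
    \<comment> \<open>The only overwritten entries belong to \<open>K\<close>, which exceeds
      \<open>k\<close>, and to \<open>q K\<close>, which is an upper end.\<close>
    have X'l: "X' j = X j" if "j \<le> k" "long_at q j" for j
      using that nlq by (intro X'eq) (auto simp: K_def)
    have split: "j \<in> {1..Suc k} \<Longrightarrow> j = K \<or> j \<in> {1..k}" for j by (auto simp: K_def)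
    show ?thesis unfolding s' sweep_inv_def prod.case
    proof (intro conjI ballI allI impI)
      fix j assume j: "j \<in> {1..n}"
      show "X' j = 0 \<longleftrightarrow> \<not> (long_at q j \<and> j \<le> Suc k \<or> long_at q (q j) \<and> q j \<le> Suc k)"
      proof (cases "j = K \<or> j = q K")
        case True
        then show ?thesis using X'K lK c qKn by (auto simp: K_def)
      next
        case False
        then have "q j \<noteq> K" using q_q[OF j] by auto
        then show ?thesis using False Xz[OF j] X'eq[of j] by (auto simp: K_def le_Suc_eq)
      qed
      show "X' (q j) = X' j"
      proof (cases "j = K \<or> j = q K")
        case True
        then show ?thesis using X'K qKn by auto
      next
        case False
        then have "q j \<noteq> K" "q j \<noteq> q K" using q_q[OF j] q_inj[OF j K] by auto
        then show ?thesis using False X'eq Xq[OF j] by auto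
      qed
    next
      fix j assume j: "j \<in> {1..Suc k}" "long_at q j"
      show "q j \<le> T' (X' j)"
      proof (cases "j = K")
        case True
        then show ?thesis using X'K by (simp add: T'_def)
      next
        case False
        then have jk: "j \<in> {1..k}" using split[OF j(1)] by simp
        then show ?thesis using Tge[OF jk j(2)] X'l[of j] j c(2) True by (auto simp: T'_def K_def)
      qed
      show "\<exists>i\<in>{1..<j}. long_at q i \<and> X' i = c' \<and> j < q i" if c': "c' \<in> {1..<X' j}" for c'
      proof (cases "j = K")
        case True
        \<comment> \<open>A track below \<open>c\<close> was rejected because it is occupied beyond
          \<open>K\<close>; the edge attaining \<open>T c'\<close> is the blocker sought.\<close>
        then have "K < T c'" using c' cmin[of c'] X'K by auto
        then obtain i where i: "i \<in> {1..k}" "long_at q i" "X i = c'" "q i = T c'"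
          using Tex[of c'] c' by auto
        then show ?thesis using X'l[of i] \<open>K < T c'\<close> True by (intro bexI[of _ i]) (auto simp: K_def)
      next
        case False
        then have jk: "j \<in> {1..k}" using split[OF j(1)] by simp
        then obtain i where i: "i \<in> {1..<j}" "long_at q i" "X i = c'" "j < q i"
          using low[OF jk j(2), of c'] X'l[of j] j c' by auto
        then show ?thesis using X'l[of i] jk by (intro bexI[of _ i]) auto
      qed
    next
      fix i j assume j: "j \<in> {1..Suc k}" and i: "i \<in> {1..<j}" and l: "long_at q i" "long_at q j" and eq: "X' i = X' j"
      have ik: "i \<in> {1..k}" using i j by auto
      show "q i < j"
      proof (cases "j = K")
        case True
        then have "X i = c" using eq X'K X'l[of i] ik l by auto
        then have "q i \<le> K" using Tge[OF ik l(1)] c by simp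
        \<comment> \<open>The test for a free track admits equality, but \<open>K\<close> is the
          lower end of its own edge and so cannot be the upper end of another.\<close>
        moreover have "q i \<noteq> K"
        proof
          assume "q i = K"
          then have "q K = i" using q_q[of i] ik assms(2) by auto
          then show False using \<open>Suc K < q K\<close> ik by (auto simp: K_def)
        qed
        ultimately show ?thesis using True by simp
      next
        case False
        then have jk: "j \<in> {1..k}" using split[OF j] by simp
        then show ?thesis using dis[OF jk i l] eq X'l[of i] X'l[of j] ik l by auto
      qed
    next
      fix c' :: nat assume c': "0 < c'" "T' c' \<noteq> 0"
      show "\<exists>j\<in>{1..Suc k}. long_at q j \<and> X' j = c' \<and> q j = T' c'"
      proof (cases "c' = c")
        case True
        then show ?thesis using lK X'K by (intro bexI[of _ K]) (auto simp: T'_def K_def)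
      next
        case False
        then obtain j where "j \<in> {1..k}" "long_at q j" "X j = c'" "q j = T' c'"
          using Tex[of c'] c' by (auto simp: T'_def)
        then show ?thesis using X'l[of j] by (intro bexI[of _ j]) auto
      qed
    qed
  qed
qed

lemma sweep_inv: "k \<le> n \<Longrightarrow> sweep_inv k (sweep q k)"
proof (induction k)
  case 0
  show ?case by (auto simp: sweep_inv_def long_at_def)
next
  case (Suc k)
  then show ?case using sweep_inv_step by simp
qed

definition track :: "nat \<Rightarrow> nat" where "track = fst (sweep q n)"

lemma track_zero: "j \<in> {1..n} \<Longrightarrow> track j = 0 \<longleftrightarrow> \<not> long_at q j \<and> \<not> long_at q (q j)"
  using sweep_inv[of n] q_range[of j] unfolding sweep_inv_def track_def by (auto simp: case_prod_beta)

lemma track_q: "j \<in> {1..n} \<Longrightarrow> track (q j) = track j"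
  using sweep_inv[of n] unfolding sweep_inv_def track_def by (auto simp: case_prod_beta)

lemma track_disjoint:
  "j \<in> {1..n} \<Longrightarrow> i \<in> {1..<j} \<Longrightarrow> long_at q i \<Longrightarrow> long_at q j \<Longrightarrow> track i = track j \<Longrightarrow> q i < j"
  using sweep_inv[of n] unfolding sweep_inv_def track_def by (auto simp: case_prod_beta)

lemma track_blocked:
  "j \<in> {1..n} \<Longrightarrow> long_at q j \<Longrightarrow> c \<in> {1..<track j} \<Longrightarrow>
     \<exists>i\<in>{1..<j}. long_at q i \<and> track i = c \<and> j < q i"
  using sweep_inv[of n] unfolding sweep_inv_def track_def by (auto simp: case_prod_beta)

end

section \<open>Axis-parallel chains and bounding boxes\<close>

text \<open>An overlap is witnessed by a nondegenerate segment, which has infinitely many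
  points.\<close>

lemma not_overlap_if_finite: "finite (A \<inter> B) \<Longrightarrow> \<not> overlap A B"
  unfolding overlap_def by (metis finite_closed_segment finite_subset)

lemma closed_segment_vertical: "closed_segment (x, a) (x, b) = {x} \<times> closed_segment a (b :: real)"
  for x :: real
  by (simp add: closed_segment_same_fst)

lemma closed_segment_horizontal: "closed_segment (a, y) (b, y) = closed_segment a b \<times> {y}"
  for y a b :: real
  by (simp add: closed_segment_same_snd)

text \<open>No order is assumed: \<open>b\<close> may lie outside the segment, which covers chains
  that leave the range between their ends.\<close>

lemma closed_segment_subset_union: "closed_segment a c \<subseteq> closed_segment a b \<union> closed_segment b c"
  for a b c :: real
  by (auto simp: closed_segment_eq_real_ivl split: if_splits)

definition chain :: "nat \<Rightarrow> real \<Rightarrow> real \<Rightarrow> point list" where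
  "chain x a b = (if x = 0 then [(0, a), (0, b)]
     else [(0, a), (real x, a), (real x, b), (0, b)])"

lemma segments_chain:
  "segments (chain x a b) = (if x = 0 then [((0, a), (0, b))]
     else [((0, a), (real x, a)), ((real x, a), (real x, b)), ((real x, b), (0, b))])"
  by (simp add: segments_def chain_def)

lemma curve_chain: "curve (chain x a b) = {0..real x} \<times> {a, b} \<union> {real x} \<times> closed_segment a b"
  unfolding curve_def segments_chain
  by (auto simp: closed_segment_vertical closed_segment_horizontal closed_segment_eq_real_ivl)

text \<open>The horizontal pieces have different heights, and the vertical piece meets each of them
  in one corner only, so any two pieces have finitely many common points.\<close>

lemma polygonal_chain_chain:
  assumes "a \<noteq> b"
  shows "polygonal_chain (chain x a b)"
proof (cases "x = 0")
  case True
  then show ?thesis using assms by (simp add: polygonal_chain_def segments_chain) (simp add: chain_def)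
next
  case False
  let ?s = "segments (chain x a b)"
  have "\<not> overlap (closed_segment (fst (?s ! i)) (snd (?s ! i))) (closed_segment (fst (?s ! j)) (snd (?s ! j)))"
    if "i < j" "j < length ?s" for i j
  proof -
    have "i = 0 \<and> j = 1 \<or> i = 0 \<and> j = 2 \<or> i = 1 \<and> j = 2"
      using that False by (auto simp: segments_chain)
    then show ?thesis using False assms
      by (intro not_overlap_if_finite)
        (auto simp: segments_chain closed_segment_vertical closed_segment_horizontal Times_Int_Times)
  qed
  moreover have "2 \<le> length (chain x a b)" by (simp add: chain_def)
  moreover have "\<forall>(p, r)\<in>set ?s. p \<noteq> r" using False assms by (simp add: segments_chain)
  ultimately show ?thesis unfolding polygonal_chain_def by blast
qed

text \<open>The height changes only along vertical segments. With at most two bends and both ends on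
  the axis, all vertical segments lie on one common grid line, so together they cover the interval
  from \<open>a\<close> to \<open>b\<close> there.\<close>

lemma vertical_track:
  assumes ends: "2 \<le> length c" "hd c = (0, a)" "last c = (0, b)" "a \<noteq> b"
    and bends: "length (bends c) \<le> 2" "\<forall>p\<in>set (bends c). integer_point p"
    and grid: "\<forall>(p, r)\<in>set (segments c). on_grid_line p r"
    and right: "curve c \<subseteq> {p. 0 \<le> fst p}"
  shows "\<exists>x::nat. {real x} \<times> closed_segment a b \<subseteq> curve c"
proof -
  have "length c = 2 \<or> length c = 3 \<or> length c = 4" using ends(1) bends(1) by (auto simp: bends_def)
  then consider p r where "c = [p, r]" | p r s where "c = [p, r, s]" | p r s t where "c = [p, r, s, t]"
    by (auto simp: numeral_eq_Suc length_Suc_conv)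
  then show ?thesis
  proof cases
    case 1
    then have "curve c = {0} \<times> closed_segment a b"
      using ends by (simp add: curve_def segments_def closed_segment_vertical)
    then show ?thesis by (intro exI[of _ 0]) simp
  next
    case (2 p r s)
    obtain x1 y1 where r: "r = (x1, y1)" by fastforce
    have c: "c = [(0, a), (x1, y1), (0, b)]" using 2 ends r by simp
    \<comment> \<open>A single bend off the axis would need the heights \<open>a\<close> and
      \<open>b\<close> at once.\<close>
    then have "x1 = 0" using grid ends(4) by (auto simp: segments_def on_grid_line_def)
    then have "curve c = {0} \<times> (closed_segment a y1 \<union> closed_segment y1 b)"
      using c by (auto simp: curve_def segments_def closed_segment_vertical)
    then show ?thesis using closed_segment_subset_union[of a b y1] by (intro exI[of _ 0]) auto
  next
    case (3 p r s t)
    obtain x1 y1 x2 y2 where rs: "r = (x1, y1)" "s = (x2, y2)" by fastforce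
    have c: "c = [(0, a), (x1, y1), (x2, y2), (0, b)]" using 3 ends rs by simp
    have g: "x1 = 0 \<or> y1 = a" "x1 = x2 \<or> y1 = y2" "x2 = 0 \<or> y2 = b"
      using grid by (auto simp: c segments_def on_grid_line_def)
    have cu: "curve c = closed_segment (0, a) (x1, y1) \<union> closed_segment (x1, y1) (x2, y2) \<union> closed_segment (x2, y2) (0, b)"
      by (auto simp: c curve_def segments_def)
    have "(x1, y1) \<in> curve c" by (simp add: cu)
    then have "0 \<le> x1" using right by auto
    moreover have "x1 \<in> \<int>" using bends(2) by (simp add: c bends_def integer_point_def)
    ultimately obtain k :: nat where k: "x1 = real k" by (metis Ints_cases nonneg_int_cases of_int_0_le_iff of_int_of_nat_eq)
    \<comment> \<open>The change of height is carried by the middle segment, by all three along the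
      axis, by the first one, and by the last one, respectively.\<close>
    consider "x1 \<noteq> 0" "x2 = x1" | "x1 = 0" "x2 = 0" | "x1 = 0" "x2 \<noteq> 0" | "x1 \<noteq> 0" "x2 \<noteq> x1"
      by metis
    then show ?thesis
    proof cases
      case 1
      then show ?thesis using g k by (intro exI[of _ k]) (auto simp: cu closed_segment_vertical)
    next
      case 2
      then have "curve c = {0} \<times> (closed_segment a y1 \<union> closed_segment y1 y2 \<union> closed_segment y2 b)"
        unfolding cu by (auto simp: closed_segment_vertical)
      then show ?thesis
        using closed_segment_subset_union[of a b y1] closed_segment_subset_union[of y1 b y2]
        by (intro exI[of _ 0]) auto
    next
      case 3
      then show ?thesis using g by (intro exI[of _ 0]) (auto simp: cu closed_segment_vertical)
    next
      case 4
      then show ?thesis using g ends(4) by (intro exI[of _ 0]) (auto simp: cu closed_segment_vertical)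
    qed
  qed
qed

section \<open>Area of the bounding box\<close>

lemma bounding_box_subset: "X \<subseteq> cbox a b \<Longrightarrow> bounding_box X \<subseteq> cbox a b"
  unfolding bounding_box_def by blast

lemma closed_bounding_box: "closed (bounding_box X)"
  unfolding bounding_box_def by (intro closed_Inter) auto

lemma measure_rectangle:
  fixes w h k :: real
  assumes "0 \<le> w" "h \<le> k"
  shows "measure lborel (cbox (0, h) (w, k)) = w * (k - h)"
  using assms by (simp add: measure_lborel_cbox_eq Basis_prod_def prod.union_disjoint sum.union_disjoint)

lemma measure_bounding_box_le:
  fixes w h k :: real
  assumes "X \<subseteq> cbox (0, h) (w, k)" "0 \<le> w" "h \<le> k"
  shows "measure lborel (bounding_box X) \<le> w * (k - h)"
proof -
  have "measure lborel (bounding_box X) \<le> measure lborel (cbox (0, h) (w, k))"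
    using bounding_box_subset[OF assms(1)] closed_bounding_box[of X]
    by (intro measure_mono_fmeasurable) (auto simp: fmeasurable_cbox)
  then show ?thesis using measure_rectangle assms by simp
qed

text \<open>Every box around \<open>X\<close> contains the three points and hence the rectangle.
  Boundedness excludes the empty intersection, for which the bounding box would be the whole plane
  and \<open>measure\<close> would return 0.\<close>

lemma measure_bounding_box_ge:
  fixes w h k :: real
  assumes "bounded X" "(0, h) \<in> X" "(0, k) \<in> X" "(w, t) \<in> X" "0 \<le> w" "h \<le> k"
  shows "w * (k - h) \<le> measure lborel (bounding_box X)"
proof -
  obtain a b where "X \<subseteq> cbox a b" using bounded_subset_cbox_symmetric[OF assms(1)] by blast
  then have "bounding_box X \<subseteq> cbox a b" by (rule bounding_box_subset)
  then have fin: "bounding_box X \<in> fmeasurable lborel"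
    using closed_bounding_box[of X] by (intro fmeasurableI2[OF fmeasurable_cbox]) auto
  have "cbox (0, h) (w, k) \<subseteq> cbox a b" if "X \<subseteq> cbox a b" for a b :: point
  proof -
    have "(0, h) \<in> cbox a b" "(0, k) \<in> cbox a b" "(w, t) \<in> cbox a b" using that assms by auto
    then show ?thesis by (cases a, cases b) (auto simp: cbox_Pair_eq)
  qed
  then have "cbox (0, h) (w, k) \<subseteq> bounding_box X" unfolding bounding_box_def by blast
  then have "measure lborel (cbox (0, h) (w, k)) \<le> measure lborel (bounding_box X)"
    by (intro measure_mono_fmeasurable[OF _ _ fin]) auto
  then show ?thesis using measure_rectangle assms by simp
qed

lemma bounded_curve: "bounded (curve c)"
  unfolding curve_def by (auto simp: bounded_closed_segment intro!: bounded_UN)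

section \<open>Optimality of the greedy drawing\<close>

locale matching_instance =
  fixes n :: nat and S :: "point set" and E :: "nat set set" and \<mu> :: "nat \<Rightarrow> point"
    and es :: "(nat \<times> nat) list"
  assumes S: "finite S" "card S = n" "\<forall>p\<in>S. fst p = 0 \<and> integer_point p"
    and matching: "perfect_matching {..<n} E"
    and bij: "bij_betw \<mu> {..<n} S"
    and edges: "lists_edges es E"
begin

section \<open>Heights, ranks and positions\<close>

definition height :: "nat \<Rightarrow> int" where "height v = \<lfloor>snd (\<mu> v)\<rfloor>"

lemma \<mu>_eq: "v < n \<Longrightarrow> \<mu> v = (0, of_int (height v))"
proof -
  assume "v < n"
  then have "\<mu> v \<in> S" using bij by (auto simp: bij_betw_def)
  then show ?thesis using S(3) unfolding integer_point_def height_def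
    by (metis floor_of_int Ints_cases prod.collapse)
qed

lemma height_inj: "u < n \<Longrightarrow> v < n \<Longrightarrow> height u = height v \<Longrightarrow> u = v"
  using inj_onD[OF bij_betw_imp_inj_on[OF bij], of u v] by (simp add: \<mu>_eq)

text \<open>Counting with \<open>\<le>\<close> includes \<open>v\<close> itself, so positions start
  at 1. The machine performs exactly this count.\<close>

definition rank :: "nat \<Rightarrow> nat" where "rank v = card {w. w < n \<and> height w \<le> height v}"

lemma rank_less:
  assumes "u < n" "v < n"
  shows "rank u < rank v \<longleftrightarrow> height u < height v"
proof -
  have *: "rank u < rank v" if "height u < height v" "v < n" for u v
    unfolding rank_def
  proof (rule psubset_card_mono)
    have "v \<in> {w. w < n \<and> height w \<le> height v}" "v \<notin> {w. w < n \<and> height w \<le> height u}"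
      using that by auto
    moreover have "{w. w < n \<and> height w \<le> height u} \<subseteq> {w. w < n \<and> height w \<le> height v}"
      using that by (intro Collect_mono) linarith
    ultimately show "{w. w < n \<and> height w \<le> height u} \<subset> {w. w < n \<and> height w \<le> height v}"
      by blast
  qed simp
  show ?thesis
  proof (cases "height u" "height v" rule: linorder_cases)
    case equal
    then show ?thesis using height_inj assms by blast
  qed (use *[of u v] *[of v u] assms in auto)
qed

lemma rank_inj:
  assumes "u < n" "v < n" "rank u = rank v"
  shows "u = v"
proof -
  have "\<not> height u < height v" "\<not> height v < height u"
    using rank_less[OF assms(1,2)] rank_less[OF assms(2,1)] assms(3) by simp_all
  then show ?thesis using height_inj[OF assms(1,2)] by linarith
qed

lemma rank_range: assumes "v < n" shows "rank v \<in> {1..n}"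
proof -
  have "rank v \<le> card {..<n}" unfolding rank_def by (intro card_mono) auto
  moreover have "card {v} \<le> rank v" unfolding rank_def using assms by (intro card_mono) auto
  ultimately show ?thesis by simp
qed

lemma bij_rank: "bij_betw rank {..<n} {1..n}"
  unfolding bij_betw_def
proof
  show inj: "inj_on rank {..<n}" using rank_inj by (auto simp: inj_on_def)
  show "rank ` {..<n} = {1..n}"
    using rank_range card_image[OF inj] by (intro card_subset_eq) auto
qed

definition vert :: "nat \<Rightarrow> nat" where "vert = inv_into {..<n} rank"

lemma vert_less: "k \<in> {1..n} \<Longrightarrow> vert k < n"
  using bij_rank inv_into_into[of k rank "{..<n}"] unfolding vert_def bij_betw_def by auto

lemma rank_vert: "k \<in> {1..n} \<Longrightarrow> rank (vert k) = k"
  using bij_rank unfolding vert_def bij_betw_def by (metis f_inv_into_f)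

lemma vert_rank: "v < n \<Longrightarrow> vert (rank v) = v"
  using bij_rank unfolding vert_def bij_betw_def by (simp add: inv_into_f_f)

definition level :: "nat \<Rightarrow> real" where "level k = of_int (height (vert k))"

lemma level_less: "i \<in> {1..n} \<Longrightarrow> j \<in> {1..n} \<Longrightarrow> level i < level j \<longleftrightarrow> i < j"
  using rank_less[of "vert i" "vert j"] vert_less rank_vert by (simp add: level_def)

lemma level_le: "i \<in> {1..n} \<Longrightarrow> j \<in> {1..n} \<Longrightarrow> level i \<le> level j \<longleftrightarrow> i \<le> j"
  using level_less[of j i] by linarith

lemma level_rank: "v < n \<Longrightarrow> level (rank v) = of_int (height v)"
  by (simp add: level_def vert_rank)

lemma \<mu>_vert: "k \<in> {1..n} \<Longrightarrow> \<mu> (vert k) = (0, level k)"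
  by (simp add: \<mu>_eq vert_less level_def)

section \<open>Partners and the position of an edge\<close>

lemma edge_props:
  assumes "{u, v} \<in> E"
  shows "u < n" "v < n" "u \<noteq> v"
  using assms matching unfolding perfect_matching_def by force+

lemma edge_unique: "e \<in> E \<Longrightarrow> f \<in> E \<Longrightarrow> v \<in> e \<Longrightarrow> v \<in> f \<Longrightarrow> e = f"
  using matching unfolding perfect_matching_def by (metis subsetD)

lemma edge_at_vertex: assumes "v < n" shows "\<exists>w. {v, w} \<in> E"
proof -
  obtain e where e: "e \<in> E" "v \<in> e" using matching assms unfolding perfect_matching_def by (metis lessThan_iff)
  then have "card e = 2" using matching unfolding perfect_matching_def by blast
  then obtain a b where "e = {a, b}" by (auto simp: card_2_iff)
  then show ?thesis using e by (auto simp: insert_commute)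
qed

definition mate :: "nat \<Rightarrow> nat" where "mate v = (SOME w. {v, w} \<in> E)"

lemma mate_edge: "v < n \<Longrightarrow> {v, mate v} \<in> E"
  unfolding mate_def using edge_at_vertex by (rule someI_ex)

lemma mate_eq: "{v, w} \<in> E \<Longrightarrow> mate v = w"
  using edge_unique[of "{v, w}" "{v, mate v}" v] mate_edge[of v] edge_props[of v w] edge_props[of v "mate v"]
  by (auto simp: doubleton_eq_iff)

text \<open>The matching transported from vertices to positions; this is the involution on which
  \<open>sweep\<close> operates.\<close>

definition opposite :: "nat \<Rightarrow> nat" where "opposite k = rank (mate (vert k))"

lemma opposite_rank: "{u, v} \<in> E \<Longrightarrow> opposite (rank u) = rank v"
  unfolding opposite_def using mate_eq edge_props vert_rank by auto

lemma edge_at: assumes "k \<in> {1..n}" shows "{vert k, vert (opposite k)} \<in> E" "opposite k \<in> {1..n}"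
proof -
  have e: "{vert k, mate (vert k)} \<in> E" using mate_edge[OF vert_less[OF assms]] .
  then show "opposite k \<in> {1..n}" unfolding opposite_def using edge_props rank_range by blast
  show "{vert k, vert (opposite k)} \<in> E" unfolding opposite_def using e edge_props(2) vert_rank by metis
qed

sublocale involution opposite n
proof
  fix k assume k: "k \<in> {1..n}"
  show "opposite k \<in> {1..n}" using edge_at(2)[OF k] .
  have "opposite (rank (vert (opposite k))) = rank (vert k)"
    using edge_at(1)[OF k] by (intro opposite_rank) (simp add: insert_commute)
  then show "opposite (opposite k) = k" using rank_vert k edge_at(2)[OF k] by simp
qed

lemma opposite_neq: "k \<in> {1..n} \<Longrightarrow> opposite k \<noteq> k"
  using edge_at[of k] edge_props(3) by metis

text \<open>An edge may be listed in either direction. Naming its lower end \<open>i\<close> once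
  spares all later arguments the symmetric case.\<close>

lemma edge_position:
  assumes "{u, v} \<in> E"
  obtains i where "i \<in> {1..n}" "i < opposite i" "{u, v} = {vert i, vert (opposite i)}"
    "closed_segment (of_int (height u)) (of_int (height v)) = {level i..level (opposite i)}"
    "track (rank u) = track i"
proof -
  have uv: "u < n" "v < n" "u \<noteq> v" using edge_props[OF assms] by auto
  have vu: "{v, u} \<in> E" using assms by (simp add: insert_commute)
  note o = opposite_rank[OF assms] opposite_rank[OF vu]
  have "rank u \<noteq> rank v" using rank_inj uv by blast
  then consider "rank u < rank v" | "rank v < rank u" by linarith
  then show ?thesis
  proof cases
    case 1
    then show ?thesis using that[of "rank u"] uv o rank_less[of u v] rank_range[of u]
      by (simp add: vert_rank level_rank closed_segment_eq_real_ivl)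
  next
    case 2
    then show ?thesis using that[of "rank v"] uv o rank_less[of v u] rank_range[of v] track_q[of "rank v"]
      by (simp add: vert_rank level_rank closed_segment_eq_real_ivl insert_commute)
  qed
qed

lemma track_pos_iff: "i \<in> {1..n} \<Longrightarrow> i < opposite i \<Longrightarrow> 0 < track i \<longleftrightarrow> long_at opposite i"
  using track_zero[of i] q_q[of i] by (auto simp: long_at_def)

text \<open>On positive tracks this is the proper colouring. On track 0 edges join consecutive
  positions, so the one starting lower ends no later than position \<open>j\<close>, and equality is
  excluded.\<close>

lemma same_track_disjoint:
  assumes i: "i \<in> {1..n}" "i < opposite i" and j: "j \<in> {1..n}" "j < opposite j"
    and "i < j" "track i = track j" "opposite i \<noteq> j"
  shows "level (opposite i) < level j"
proof -
  have "opposite i < j"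
  proof (cases "track i = 0")
    case True
    then have "\<not> long_at opposite i" using track_pos_iff[OF i] by simp
    then have "opposite i \<le> Suc i" using i by (simp add: long_at_def)
    then show ?thesis using assms by simp
  next
    case False
    then have "long_at opposite i" "long_at opposite j" using track_pos_iff[OF i] track_pos_iff[OF j] assms(6) by auto
    then show ?thesis using track_disjoint[of j i] i j assms by auto
  qed
  then show ?thesis using level_less edge_at(2) i j by simp
qed

lemma edges_disjoint:
  assumes e: "{u, v} \<in> E" and f: "{u', v'} \<in> E" and neq: "{u, v} \<noteq> {u', v'}"
    and tr: "track (rank u) = track (rank u')"
  shows "closed_segment (real_of_int (height u)) (of_int (height v)) \<inter>
    closed_segment (of_int (height u')) (of_int (height v')) = {}"
proof -
  obtain i where i: "i \<in> {1..n}" "i < opposite i" "{u, v} = {vert i, vert (opposite i)}"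
    "closed_segment (of_int (height u)) (real_of_int (height v)) = {level i..level (opposite i)}"
    "track (rank u) = track i" using edge_position[OF e] .
  obtain j where j: "j \<in> {1..n}" "j < opposite j" "{u', v'} = {vert j, vert (opposite j)}"
    "closed_segment (of_int (height u')) (real_of_int (height v')) = {level j..level (opposite j)}"
    "track (rank u') = track j" using edge_position[OF f] .
  have "i \<noteq> j" "opposite i \<noteq> j" "opposite j \<noteq> i" using i j neq q_q by auto
  then consider "level (opposite i) < level j" | "level (opposite j) < level i"
    using same_track_disjoint[of i j] same_track_disjoint[of j i] i j tr by (metis linorder_neqE_nat)
  then show ?thesis using i(4) j(4) by cases auto
qed

section \<open>The greedy drawing is a valid drawing\<close>

definition drawing :: "nat set \<Rightarrow> point list" where
  "drawing e = (let (u, v) = (SOME (u, v). (u, v) \<in> set es \<and> {u, v} = e)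
     in chain (track (rank u)) (of_int (height u)) (of_int (height v)))"

text \<open>A chain has a direction but an edge, being a set, has none. The choice in
  \<open>drawing\<close> recovers the listed pair, unique because no edge is listed twice, so the
  corners come in the order in which the machine prints them.\<close>

lemma drawing_eq:
  assumes "(u, v) \<in> set es"
  shows "drawing {u, v} = chain (track (rank u)) (of_int (height u)) (of_int (height v))"
proof -
  have inj: "inj_on (\<lambda>(u, v). {u, v}) (set es)"
    using edges unfolding lists_edges_def by (simp add: distinct_map)
  have "(SOME (a, b). (a, b) \<in> set es \<and> {a, b} = {u, v}) = (u, v)"
  proof (rule some_equality)
    show "case (u, v) of (a, b) \<Rightarrow> (a, b) \<in> set es \<and> {a, b} = {u, v}" using assms by simp
    fix p assume "case p of (a, b) \<Rightarrow> (a, b) \<in> set es \<and> {a, b} = {u, v}"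
    then show "p = (u, v)" using inj_onD[OF inj, of p "(u, v)"] assms by auto
  qed
  then show ?thesis by (simp add: drawing_def)
qed

lemma listed_edge: assumes "(u, v) \<in> set es" shows "{u, v} \<in> E"
  using assms edges unfolding lists_edges_def by force

lemma edge_listed:
  assumes "e \<in> E"
  obtains u v where "(u, v) \<in> set es" "e = {u, v}"
  using assms edges unfolding lists_edges_def by (auto simp: image_iff)

lemma curve_drawing:
  assumes "(u, v) \<in> set es"
  shows "curve (drawing {u, v}) = {0..real (track (rank u))} \<times> {of_int (height u), of_int (height v)} \<union>
    {real (track (rank u))} \<times> closed_segment (of_int (height u)) (of_int (height v))"
  by (simp add: drawing_eq[OF assms] curve_chain)

text \<open>Horizontal pieces of different edges have different heights, and vertical pieces on one
  track are disjoint. What remains are crossings of a track with an end height, finitely many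
  points.\<close>

lemma drawing_no_overlap:
  assumes "e \<in> E" "f \<in> E" "e \<noteq> f"
  shows "\<not> overlap (curve (drawing e)) (curve (drawing f))"
proof -
  obtain u v where e: "(u, v) \<in> set es" "e = {u, v}" using edge_listed assms by blast
  obtain u' v' where f: "(u', v') \<in> set es" "f = {u', v'}" using edge_listed assms by blast
  have E: "{u, v} \<in> E" "{u', v'} \<in> E" "{u, v} \<noteq> {u', v'}" using e f assms by auto
  have "u \<noteq> u'" "u \<noteq> v'" "v \<noteq> u'" "v \<noteq> v'" using edge_unique[OF E(1,2)] E(3) by blast+
  then have h: "height u \<noteq> height u'" "height u \<noteq> height v'" "height v \<noteq> height u'" "height v \<noteq> height v'"
    using height_inj edge_props[OF E(1)] edge_props[OF E(2)] by blast+
  have "curve (drawing e) \<inter> curve (drawing f) \<subseteq>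
      {real (track (rank u)), real (track (rank u'))} \<times>
      {of_int (height u), of_int (height v), of_int (height u'), of_int (height v')}"
    using edges_disjoint[OF E] h unfolding e(2) f(2) curve_drawing[OF e(1)] curve_drawing[OF f(1)] by auto
  then have "finite (curve (drawing e) \<inter> curve (drawing f))" by (rule finite_subset) simp
  then show ?thesis by (rule not_overlap_if_finite)
qed

text \<open>A foreign vertex has the height of neither end, so on the curve it could lie only on a
  vertical piece along the axis. Such an edge joins consecutive positions, and no rank lies between
  them.\<close>

lemma drawing_avoids_vertices:
  assumes "e \<in> E" "w < n" "w \<notin> e"
  shows "\<mu> w \<notin> curve (drawing e)"
proof
  assume w: "\<mu> w \<in> curve (drawing e)"
  obtain u v where e: "(u, v) \<in> set es" "e = {u, v}" using edge_listed assms by blast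
  have E: "{u, v} \<in> E" using e assms by simp
  note uv = edge_props[OF E]
  have h: "height w \<noteq> height u" "height w \<noteq> height v" using height_inj assms e uv by auto
  obtain i where i: "i \<in> {1..n}" "i < opposite i" "{u, v} = {vert i, vert (opposite i)}"
    "closed_segment (of_int (height u)) (real_of_int (height v)) = {level i..level (opposite i)}"
    "track (rank u) = track i" using edge_position[OF E] .
  have t: "track i = 0" "real_of_int (height w) \<in> {level i..level (opposite i)}"
    using w h i(4,5) unfolding e(2) curve_drawing[OF e(1)] \<mu>_eq[OF assms(2)] by auto
  then have "opposite i = Suc i" using track_pos_iff[of i] i by (auto simp: long_at_def)
  moreover have "i \<le> rank w" "rank w \<le> opposite i"
    using t(2) level_le[of i "rank w"] level_le[of "rank w" "opposite i"] rank_range[OF assms(2)] i(1)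
      edge_at(2)[OF i(1)] level_rank[OF assms(2)] by auto
  ultimately have "rank w = i \<or> rank w = opposite i" by linarith
  then have "w = vert i \<or> w = vert (opposite i)" using vert_rank assms by metis
  then show False using assms(3) e i(3) by auto
qed

lemma drawing_crossing:
  assumes "e \<in> E" "f \<in> E" "e \<noteq> f"
    and ab: "(a, b) \<in> set (segments (drawing e))" and cd: "(c, d) \<in> set (segments (drawing f))"
    and cross: "open_segment a b \<inter> open_segment c d \<noteq> {}"
  shows "orthogonal (b - a) (d - c)"
proof -
  obtain u v where e: "(u, v) \<in> set es" "e = {u, v}" using edge_listed assms by blast
  obtain u' v' where f: "(u', v') \<in> set es" "f = {u', v'}" using edge_listed assms by blast
  have E: "{u, v} \<in> E" "{u', v'} \<in> E" "{u, v} \<noteq> {u', v'}" using e f assms by auto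
  have "u \<noteq> u'" "u \<noteq> v'" "v \<noteq> u'" "v \<noteq> v'" using edge_unique[OF E(1,2)] E(3) by blast+
  then have h: "height u \<noteq> height u'" "height u \<noteq> height v'" "height v \<noteq> height u'" "height v \<noteq> height v'"
    using height_inj edge_props[OF E(1)] edge_props[OF E(2)] by blast+
  have dir: "(snd a = snd b \<and> snd a \<in> {of_int (height u), of_int (height v)}) \<or>
      a = (real (track (rank u)), of_int (height u)) \<and> b = (real (track (rank u)), of_int (height v))"
    if "(a, b) \<in> set (segments (drawing {u, v}))" "(u, v) \<in> set es" for a b u v
    using that(1) unfolding drawing_eq[OF that(2)] segments_chain by (auto split: if_splits)
  note d1 = dir[OF ab[unfolded e(2)] e(1)] and d2 = dir[OF cd[unfolded f(2)] f(1)]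
  obtain p where p: "p \<in> closed_segment a b" "p \<in> closed_segment c d"
    using cross open_closed_segment by blast
  have hor: "snd p = snd a" if "snd a = snd b" "p \<in> closed_segment a b" for a b :: point
    using that by (auto simp: closed_segment_same_snd)
  \<comment> \<open>Mixed pairs are orthogonal. Two horizontal segments would need a common height,
    and two vertical ones a common point on one track; both are impossible for different
    edges.\<close>
  consider (hh) "snd a = snd b" "snd a \<in> {of_int (height u), of_int (height v)}"
      "snd c = snd d" "snd c \<in> {of_int (height u'), of_int (height v')}"
    | (hv) "snd a = snd b" "fst c = fst d" | (vh) "fst a = fst b" "snd c = snd d"
    | (vv) "a = (real (track (rank u)), of_int (height u))" "b = (real (track (rank u)), of_int (height v))"
      "c = (real (track (rank u')), of_int (height u'))" "d = (real (track (rank u')), of_int (height v'))"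
    using d1 d2 by auto
  then show ?thesis
  proof cases
    case hh
    then show ?thesis using hor[of a b] hor[of c d] p h by auto
  next
    case vv
    then show ?thesis using p edges_disjoint[OF E] by (auto simp: closed_segment_vertical)
  qed (auto simp: orthogonal_def inner_prod_def)
qed

lemma right_drawing: "right_RAC2_drawing {..<n} E \<mu> drawing"
  unfolding right_RAC2_drawing_def
proof (intro conjI)
  show "respecting_drawing {..<n} E \<mu> drawing"
    unfolding respecting_drawing_def
  proof (intro conjI ballI impI)
    fix e assume "e \<in> E"
    then obtain u v where e: "(u, v) \<in> set es" "e = {u, v}" using edge_listed by blast
    note uv = edge_props[OF listed_edge[OF e(1)]]
    have "height u \<noteq> height v" using height_inj uv by blast
    then show "polygonal_chain (drawing e)"
      unfolding e(2) drawing_eq[OF e(1)] by (intro polygonal_chain_chain) simp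
    show "\<exists>u v. e = {u, v} \<and> hd (drawing e) = \<mu> u \<and> last (drawing e) = \<mu> v"
      using uv unfolding e(2) drawing_eq[OF e(1)]
      by (intro exI[of _ u] exI[of _ v]) (simp add: chain_def \<mu>_eq)
  qed (use drawing_no_overlap drawing_avoids_vertices in auto)
  show "restricted_RAC2 E drawing"
    unfolding restricted_RAC2_def
  proof (intro conjI ballI impI)
    fix e assume "e \<in> E"
    then obtain u v where e: "(u, v) \<in> set es" "e = {u, v}" using edge_listed by blast
    show "length (bends (drawing e)) \<le> 2" "\<And>b. b \<in> set (bends (drawing e)) \<Longrightarrow> integer_point b"
      unfolding e(2) drawing_eq[OF e(1)] by (auto simp: bends_def chain_def integer_point_def split: if_splits)
    show "case s of (p, r) \<Rightarrow> on_grid_line p r" if "s \<in> set (segments (drawing e))" for s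
      using that unfolding e(2) drawing_eq[OF e(1)]
      by (auto simp: segments_chain on_grid_line_def split: if_splits)
  next
    fix e f s assume "e \<in> E" "f \<in> E" "e \<noteq> f" "s \<in> set (segments (drawing e))"
    then show "case s of (a, b) \<Rightarrow> \<forall>(c, d)\<in>set (segments (drawing f)).
        open_segment a b \<inter> open_segment c d \<noteq> {} \<longrightarrow> orthogonal (b - a) (d - c)"
      using drawing_crossing[of e f] by blast
  qed
  show "drawing_points {..<n} E \<mu> drawing \<subseteq> {p. 0 \<le> fst p}"
  proof -
    have "0 \<le> fst p" if eE: "e \<in> E" and p: "p \<in> curve (drawing e)" for e p
    proof -
      obtain u v where e: "(u, v) \<in> set es" "e = {u, v}" using edge_listed[OF eE] .
      show ?thesis using p unfolding e(2) curve_drawing[OF e(1)] by auto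
    qed
    then show ?thesis by (auto simp: drawing_points_def \<mu>_eq)
  qed
qed

section \<open>Width bounds and minimality of the area\<close>

lemma vertex_drawn: "k \<in> {1..n} \<Longrightarrow> (0, level k) \<in> drawing_points {..<n} E \<mu> D"
  unfolding drawing_points_def by (metis UnI1 \<mu>_vert imageI lessThan_iff vert_less)

lemma drawing_in_box:
  assumes "\<And>j. j \<in> {1..n} \<Longrightarrow> track j \<le> W"
  shows "drawing_points {..<n} E \<mu> drawing \<subseteq> cbox (0, level 1) (real W, level n)"
proof -
  have lv: "level 1 \<le> real_of_int (height v)" "real_of_int (height v) \<le> level n" if "v < n" for v
    using level_le[of 1 "rank v"] level_le[of "rank v" n] rank_range[OF that] level_rank[OF that] by auto
  have "p \<in> cbox (0, level 1) (real W, level n)" if eE: "e \<in> E" and p: "p \<in> curve (drawing e)" for e p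
  proof -
    obtain u v where e: "(u, v) \<in> set es" "e = {u, v}" using edge_listed[OF eE] .
    note uv = edge_props[OF listed_edge[OF e(1)]]
    have W: "real (track (rank u)) \<le> real W" using assms rank_range uv by simp
    show ?thesis using p lv[OF uv(1)] lv[OF uv(2)] W unfolding e(2) curve_drawing[OF e(1)]
      by (auto simp: cbox_Pair_eq closed_segment_eq_real_ivl split: if_splits)
  qed
  then show ?thesis using lv by (auto simp: drawing_points_def \<mu>_eq cbox_Pair_eq)
qed

text \<open>The edge that made the sweep open track \<open>c\<close> and the edges blocking the tracks below \<open>c\<close> all
  pass the same gap between consecutive vertices. They are long, so none of them fits on the
  \<open>y\<close>-axis, and no two of them can share a vertical grid line.\<close>

lemma right_drawing_width:
  assumes D: "right_RAC2_drawing {..<n} E \<mu> D" and j: "j \<in> {1..n}"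
  shows "\<exists>x y. (x, y) \<in> drawing_points {..<n} E \<mu> D \<and> real (track j) \<le> x"
proof (cases "track j = 0")
  case True
  have "(0, level j) \<in> drawing_points {..<n} E \<mu> D"
    using vertex_drawn[OF j] .
  then show ?thesis using True by fastforce
next
  case False
  have D1: "respecting_drawing {..<n} E \<mu> D" and D2: "restricted_RAC2 E D"
    and D3: "drawing_points {..<n} E \<mu> D \<subseteq> {p. 0 \<le> fst p}"
    using D by (auto simp: right_RAC2_drawing_def)
  define edge where "edge i = {vert i, vert (opposite i)}" for i
  have "\<exists>x::nat. {real x} \<times> {level i..level (opposite i)} \<subseteq> curve (D (edge i))"
    if i: "i \<in> {1..n}" "i < opposite i" for i
  proof -
    have eE: "edge i \<in> E" unfolding edge_def using edge_at i by simp
    note o = edge_at(2)[OF i(1)]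
    have pch: "polygonal_chain (D (edge i))" using D1 eE by (auto simp: respecting_drawing_def)
    have sub: "curve (D (edge i)) \<subseteq> {p. 0 \<le> fst p}" using D3 eE by (auto simp: drawing_points_def)
    have r: "length (bends (D (edge i))) \<le> 2" "\<forall>p\<in>set (bends (D (edge i))). integer_point p"
       "\<forall>(p, r)\<in>set (segments (D (edge i))). on_grid_line p r"
      using D2 eE by (auto simp: restricted_RAC2_def)
    obtain u v where "edge i = {u, v}" "hd (D (edge i)) = \<mu> u" "last (D (edge i)) = \<mu> v"
      using D1[unfolded respecting_drawing_def, THEN conjunct1] eE by meson
    then obtain k l where kl: "hd (D (edge i)) = (0, level k)" "last (D (edge i)) = (0, level l)"
       "k = i \<and> l = opposite i \<or> k = opposite i \<and> l = i"
      using \<mu>_vert[OF i(1)] \<mu>_vert[OF o] by (metis edge_def doubleton_eq_iff)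
    have lt: "level i < level (opposite i)" using level_less i o by simp
    then have "level k \<noteq> level l" using kl(3) by auto
    then obtain x :: nat where "{real x} \<times> closed_segment (level k) (level l) \<subseteq> curve (D (edge i))"
      using vertical_track[OF _ kl(1,2) _ r sub] pch by (auto simp: polygonal_chain_def)
    moreover have "closed_segment (level k) (level l) = {level i..level (opposite i)}"
      using kl(3) lt by (auto simp: closed_segment_eq_real_ivl)
    ultimately show ?thesis by auto
  qed
  then obtain x :: "nat \<Rightarrow> nat" where
    x: "\<And>i. i \<in> {1..n} \<Longrightarrow> i < opposite i \<Longrightarrow> {real (x i)} \<times> {level i..level (opposite i)} \<subseteq> curve (D (edge i))"
    by metis
  have x_pos: "0 < x i" if i: "i \<in> {1..n}" "long_at opposite i" for i
  proof (rule ccontr)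
    assume "\<not> 0 < x i"
    note o = edge_at(2)[OF i(1)]
    have l: "Suc i < opposite i" using i by (simp add: long_at_def)
    then have Si: "Suc i \<in> {1..n}" using o by simp
    \<comment> \<open>On the axis the vertical copy would contain the vertex at the next position,
      which is not an end of this edge.\<close>
    have "\<mu> (vert (Suc i)) \<in> curve (D (edge i))"
      using x[OF i(1)] l \<open>\<not> 0 < x i\<close> \<mu>_vert[OF Si] level_le[OF i(1) Si] level_le[OF Si o] by auto
    moreover have "vert (Suc i) \<notin> edge i"
      unfolding edge_def using l rank_vert i(1) o Si by (metis insertE less_irrefl n_not_Suc_n singletonD)
    moreover have "edge i \<in> E" unfolding edge_def using edge_at i by simp
    ultimately show False
      using D1[unfolded respecting_drawing_def, THEN conjunct2, THEN conjunct2] vert_less[OF Si] by simp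
  qed
  \<comment> \<open>Position \<open>j\<close> may be an upper end, while the blocking property
    speaks of lower ends; \<open>k\<close> is the lower end of the same edge.\<close>
  obtain k where k: "k \<in> {1..n}" "long_at opposite k" "track k = track j"
    using track_zero[OF j] False j edge_at(2)[OF j] track_q[OF j] by metis
  have "\<exists>i\<in>{1..n}. long_at opposite i \<and> track i = c \<and> i \<le> k \<and> k < opposite i" if c: "c \<in> {1..track j}" for c
  proof (cases "c = track j")
    case True
    then show ?thesis using k by (intro bexI[of _ k]) (auto simp: long_at_def)
  next
    case False
    then obtain i where "i \<in> {1..<k}" "long_at opposite i" "track i = c" "k < opposite i"
      using track_blocked[OF k(1,2), of c] c k(3) by auto
    then show ?thesis using k(1) by (intro bexI[of _ i]) auto
  qed
  then obtain p where p: "\<And>c. c \<in> {1..track j} \<Longrightarrow> p c \<in> {1..n} \<and> long_at opposite (p c) \<and> track (p c) = c \<and>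
      p c \<le> k \<and> k < opposite (p c)"
    by metis
  have lt: "p c < opposite (p c)" if "c \<in> {1..track j}" for c using p[OF that] by (auto simp: long_at_def)
  have Sk: "Suc k \<in> {1..n}" using k(1,2) edge_at(2)[OF k(1)] by (auto simp: long_at_def)
  have seg: "closed_segment (real (x (p c)), level k) (real (x (p c)), level (Suc k)) \<subseteq> curve (D (edge (p c)))"
    if c: "c \<in> {1..track j}" for c
  proof -
    note pc = p[OF c]
    have "level (p c) \<le> level k" "level (Suc k) \<le> level (opposite (p c))" "level k \<le> level (Suc k)"
      using pc level_le k(1) Sk edge_at(2) by auto
    then show ?thesis using x[of "p c"] pc lt[OF c]
      by (auto simp: closed_segment_vertical closed_segment_eq_real_ivl)
  qed
  have rank_edge: "rank ` edge i = {i, opposite i}" if "i \<in> {1..n}" for i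
    using rank_vert[OF that] rank_vert[OF edge_at(2)[OF that]] by (simp add: edge_def)
  have inj: "inj_on (\<lambda>c. x (p c)) {1..track j}"
  proof (rule inj_onI, rule ccontr)
    fix c d assume c: "c \<in> {1..track j}" and d: "d \<in> {1..track j}" and eq: "x (p c) = x (p d)" and "c \<noteq> d"
    have "edge (p c) \<noteq> edge (p d)"
    proof
      assume "edge (p c) = edge (p d)"
      moreover have "rank ` edge (p c) = {p c, opposite (p c)}" "rank ` edge (p d) = {p d, opposite (p d)}"
        using rank_edge p[OF c] p[OF d] by blast+
      ultimately have "p c = p d \<or> p c = opposite (p d)" by (metis doubleton_eq_iff)
      then have "track (p c) = track (p d)" using p[OF d] track_q by metis
      then show False using p[OF c] p[OF d] \<open>c \<noteq> d\<close> by simp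
    qed
    moreover have "edge (p c) \<in> E" "edge (p d) \<in> E" unfolding edge_def using edge_at p[OF c] p[OF d] by auto
    ultimately have "\<not> overlap (curve (D (edge (p c)))) (curve (D (edge (p d))))"
      using D1[unfolded respecting_drawing_def, THEN conjunct2, THEN conjunct1] by simp
    moreover have "level k \<noteq> level (Suc k)" using level_less[OF k(1) Sk] by simp
    ultimately show False using seg[OF c] seg[OF d, folded eq] unfolding overlap_def by (metis Int_greatest Pair_inject)
  qed
  \<comment> \<open>Pigeonhole: \<open>track j\<close> distinct positive integers cannot all be
    smaller than \<open>track j\<close>.\<close>
  have "\<exists>c\<in>{1..track j}. track j \<le> x (p c)"
  proof (rule ccontr)
    assume "\<not> ?thesis"
    then have "(\<lambda>c. x (p c)) ` {1..track j} \<subseteq> {1..<track j}"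
      using x_pos p by (auto simp: Suc_le_eq)
    then have "card {1..track j} \<le> card {1..<track j}"
      using card_inj_on_le[OF inj] by blast
    then show False using False by simp
  qed
  then obtain c where c: "c \<in> {1..track j}" "track j \<le> x (p c)" by blast
  have "edge (p c) \<in> E" unfolding edge_def using edge_at p[OF c(1)] by auto
  moreover have "(real (x (p c)), level k) \<in> curve (D (edge (p c)))" using seg[OF c(1)] by auto
  ultimately show ?thesis using c(2) by (fastforce simp: drawing_points_def)
qed

lemma finite_E: "finite E"
  using edges unfolding lists_edges_def by (metis List.finite_set)

text \<open>Both areas are compared with \<open>real W * (level n - level 1)\<close>, where
  \<open>W\<close> is the largest track in use. A competitor reaching above or below all vertices
  only enlarges its own box.\<close>

theorem drawing_optimal: "min_area_right_RAC2_drawing {..<n} E \<mu> drawing"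
  unfolding min_area_right_RAC2_drawing_def
proof (intro conjI allI impI)
  show "right_RAC2_drawing {..<n} E \<mu> drawing" by (rule right_drawing)
  fix D assume D: "right_RAC2_drawing {..<n} E \<mu> D"
  show "drawing_area {..<n} E \<mu> drawing \<le> drawing_area {..<n} E \<mu> D"
  \<comment> \<open>Without vertices there is no extreme level and no maximal track, but then all
    drawings are empty.\<close>
  proof (cases "n = 0")
    case True
    then have "E = {}" using edge_props edge_listed by (metis equals0I not_less0)
    then show ?thesis by (simp add: drawing_area_def drawing_points_def)
  next
    case False
    then have n1: "1 \<in> {1..n}" "n \<in> {1..n}" by auto
    define W where "W = Max (track ` {1..n})"
    obtain j where j: "j \<in> {1..n}" "track j = W"
      using Max_in[of "track ` {1..n}"] False unfolding W_def by fastforce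
    have W: "track i \<le> W" if "i \<in> {1..n}" for i using that unfolding W_def by simp
    have le: "level 1 \<le> level n" using level_le[OF n1] False by simp
    have "drawing_area {..<n} E \<mu> drawing \<le> real W * (level n - level 1)"
      unfolding drawing_area_def by (rule measure_bounding_box_le[OF drawing_in_box[OF W] _ le]) auto
    moreover have "real W * (level n - level 1) \<le> drawing_area {..<n} E \<mu> D"
    proof -
      obtain x y where xy: "(x, y) \<in> drawing_points {..<n} E \<mu> D" "real W \<le> x"
        using right_drawing_width[OF D j(1)] j(2) by auto
      have "bounded (drawing_points {..<n} E \<mu> D)"
        unfolding drawing_points_def using finite_E bounded_curve
        by (intro bounded_Un[THEN iffD2] conjI finite_imp_bounded bounded_UN) auto
      then have "x * (level n - level 1) \<le> drawing_area {..<n} E \<mu> D"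
        unfolding drawing_area_def using xy vertex_drawn[OF n1(1)] vertex_drawn[OF n1(2)] le
        by (intro measure_bounding_box_ge) auto
      moreover have "real W * (level n - level 1) \<le> x * (level n - level 1)"
        using xy(2) le by (intro mult_right_mono) auto
      ultimately show ?thesis by simp
    qed
    ultimately show ?thesis by simp
  qed
qed

end

section \<open>The register machine program\<close>

text \<open>Register 16 holds the constant 1, register 2 holds \<open>n\<close>, and registers 3 to 8 hold the base
  addresses of the heights, of the edge list, of the ranks, of the map from each rank to the rank of its partner, and of the two
  components of \<open>sweep\<close> (the last three arrays are indexed from 1). The scalars used as scratch
  lie below 16, and the arrays start at address 20.\<close>

definition set_up :: com where
  "set_up = Block [Const 3 20, Add 4 3 2, Add 5 4 2, Add 6 5 2, Add 7 6 2, Add 8 7 2]"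

definition read_input :: com where
  "read_input = Block [Const 9 20] ;; DoWhile (Block [Read 0, Store 9 0, Add 9 9 16, Sub 10 5 9]) 10"

text \<open>Register 11 holds the height to be ranked; the increment is skipped when the height just
  read is larger.\<close>

definition count_lower :: com where
  "count_lower = Block [Const 12 0, Const 13 20] ;;
     DoWhile (Block [Load 14 13, Sub 14 14 11] ;; Unless 14 (Block [Add 12 12 16]) ;;
       Block [Add 13 13 16, Sub 14 4 13]) 14"

definition compute_ranks :: com where
  "compute_ranks = Block [Const 9 20] ;;
     DoWhile (Block [Load 11 9] ;; count_lower ;;
       Block [Add 15 9 2, Add 15 15 2, Store 15 12, Add 9 9 16, Sub 14 4 9]) 14"

definition link_ranks :: com where
  "link_ranks = Block [Add 9 3 2] ;;
     DoWhile (Block [Load 11 9, Add 11 11 5, Load 11 11, Add 9 9 16, Load 12 9, Add 12 12 5, Load 12 12,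
       Add 13 11 6, Store 13 12, Add 13 12 6, Store 13 11, Add 9 9 16, Sub 14 5 9]) 14"

text \<open>Register 9 holds the sweep position; the search continues while the last occupied
  position on the current track exceeds it.\<close>

definition find_track :: com where
  "find_track = Block [Const 12 0] ;;
     DoWhile (Block [Add 12 12 16, Add 13 12 8, Load 14 13, Sub 14 14 9]) 14"

text \<open>For position \<open>k\<close> with partner \<open>q\<close>, register 12 becomes
  \<open>k - q + 2\<close>, which is positive exactly when no long edge starts at \<open>k\<close>.
  The first store after \<open>find_track\<close> uses the address of the track entry that the
  search left in register 13.\<close>

definition assign_tracks :: com where
  "assign_tracks = Block [Const 9 1] ;;
     DoWhile (Block [Add 11 9 6, Load 11 11, Sub 12 9 11, Add 12 12 16, Add 12 12 16] ;;
       Unless 12 (find_track ;;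
         Block [Store 13 11, Add 13 9 7, Store 13 12, Add 13 11 7, Store 13 12]) ;;
       Block [Add 9 9 16, Sub 14 2 9, Add 14 14 16]) 14"

text \<open>Register 12 holds the track \<open>x\<close> and register 15 holds \<open>1 - x\<close>.
  Exactly one of them is positive, so exactly one of the two printing blocks runs.\<close>

definition print_drawing :: com where
  "print_drawing = Block [Add 9 3 2] ;;
     DoWhile (Block [Load 10 9, Add 11 10 3, Load 11 11, Add 12 10 5, Load 12 12, Add 12 12 7, Load 12 12,
         Add 9 9 16, Load 10 9, Add 13 10 3, Load 13 13, Const 10 0, Sub 15 16 12] ;;
       Unless 12 (Block [Const 14 2, Print 14, Print 10, Print 11, Print 10, Print 13]) ;;
       Unless 15 (Block [Const 14 4, Print 14, Print 10, Print 11, Print 12, Print 11,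
         Print 12, Print 13, Print 10, Print 13]) ;;
       Block [Add 9 9 16, Sub 14 5 9]) 14"

text \<open>Loops run at least once, so the empty instance must bypass them; register 0 holds
  \<open>1 - n\<close> for this test.\<close>

definition program :: com where
  "program = Block [Read 2, Const 16 1, Sub 0 16 2] ;;
     Unless 0 (set_up ;; read_input ;; compute_ranks ;; link_ranks ;; assign_tracks ;; print_drawing)"

section \<open>Input tape and memory contents\<close>

lemma length_concat_pairs: "length (concat (map (\<lambda>(u, v). [int u, int v]) es)) = 2 * length es"
  by (induction es) auto

lemma nth_concat_pairs:
  "i < length es \<Longrightarrow> concat (map (\<lambda>(u, v). [int u, int v]) es) ! (2 * i) = int (fst (es ! i))"
  "i < length es \<Longrightarrow> concat (map (\<lambda>(u, v). [int u, int v]) es) ! Suc (2 * i) = int (snd (es ! i))"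
proof (induction es arbitrary: i)
  case (Cons p es)
  {
    case 1
    then show ?case using Cons.IH(1)[of "i - 1"] by (cases i; cases p) auto
  next
    case 2
    then show ?case using Cons.IH(2)[of "i - 1"] by (cases i; cases p) auto
  }
qed auto

lemma card_less_Suc:
  "card {w. w < Suc m \<and> P w} = card {w. w < m \<and> P w} + (if P m then 1 else 0)"
proof -
  have "{w. w < Suc m \<and> P w} = (if P m then insert m {w. w < m \<and> P w} else {w. w < m \<and> P w})"
    by (auto simp: less_Suc_eq)
  then show ?thesis by simp
qed

context matching_instance
begin

definition input :: "int list" where
  "input = map height [0..<n] @ concat (map (\<lambda>(u, v). [int u, int v]) es)"

lemma encode_instance_eq: "encode_instance n \<mu> es = int n # input"
  by (simp add: encode_instance_def input_def height_def)

text \<open>The edges partition the vertices into pairs. Hence the edge list takes up as many cells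
  as the heights.\<close>

lemma twice_length_es: "2 * length es = n"
proof -
  have "n = card (\<Union>E)"
  proof -
    have "\<Union>E = {..<n}" using matching unfolding perfect_matching_def by blast
    then show ?thesis by simp
  qed
  also have "\<dots> = sum card E"
    using edge_unique finite_subset[OF _ finite_lessThan] matching unfolding perfect_matching_def
    by (intro card_Union_disjoint) (auto simp: pairwise_def disjnt_def)
  also have "\<dots> = 2 * card E" using matching unfolding perfect_matching_def by simp
  also have "card E = length es"
    using edges unfolding lists_edges_def by (metis distinct_card length_map)
  finally show ?thesis by simp
qed

lemma length_input: "length input = 2 * n"
  using twice_length_es by (simp add: input_def length_concat_pairs del: length_concat)

lemma input_height: "v < n \<Longrightarrow> input ! v = height v"
  by (simp add: input_def nth_append)

lemma input_edge:
  assumes "e < length es"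
  shows "input ! (n + 2 * e) = int (fst (es ! e))" "input ! (Suc (n + 2 * e)) = int (snd (es ! e))"
  using nth_concat_pairs[OF assms] by (auto simp: input_def nth_append)

definition bases :: "(nat \<Rightarrow> int) \<Rightarrow> bool" where
  "bases R \<longleftrightarrow> R 16 = 1 \<and> R 2 = int n \<and> R 3 = 20 \<and> R 4 = 20 + int n \<and> R 5 = 20 + 2 * int n \<and>
     R 6 = 20 + 3 * int n \<and> R 7 = 20 + 4 * int n \<and> R 8 = 20 + 5 * int n"

definition has_input :: "(nat \<Rightarrow> int) \<Rightarrow> bool" where
  "has_input R \<longleftrightarrow> bases R \<and> (\<forall>i<2 * n. R (20 + i) = input ! i)"

definition has_ranks :: "(nat \<Rightarrow> int) \<Rightarrow> bool" where
  "has_ranks R \<longleftrightarrow> has_input R \<and> (\<forall>v<n. R (20 + 2 * n + v) = int (rank v))"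

definition has_links :: "(nat \<Rightarrow> int) \<Rightarrow> bool" where
  "has_links R \<longleftrightarrow> has_ranks R \<and> (\<forall>k\<in>{1..n}. R (20 + 3 * n + k) = int (opposite k))"

definition has_tracks :: "(nat \<Rightarrow> int) \<Rightarrow> bool" where
  "has_tracks R \<longleftrightarrow> has_ranks R \<and> (\<forall>k\<in>{1..n}. R (20 + 4 * n + k) = int (track k))"

text \<open>Tracked up to the sweep, because the zeros of untouched memory serve as the initial
  values of both its tables.\<close>

definition zero_from :: "nat \<Rightarrow> (nat \<Rightarrow> int) \<Rightarrow> bool" where
  "zero_from b R \<longleftrightarrow> (\<forall>a\<ge>b. R a = 0)"

section \<open>Correctness and cost of the single phases\<close>

lemma wp_read_input:
  assumes "bases R" "zero_from 20 R" "0 < n"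
  shows "wp read_input (1 + 2 * n * Suc 4)
    (\<lambda>R i out. has_input R \<and> zero_from (20 + 2 * n) R \<and> out = []) R input []"
proof -
  define I where "I k R i out \<longleftrightarrow> bases R \<and> R 9 = 20 + int k \<and> i = drop k input \<and> out = [] \<and>
    (\<forall>a<k. R (20 + a) = input ! a) \<and> zero_from (20 + k) R" for k and R :: "nat \<Rightarrow> int" and i out :: "int list"
  have body: "wp (Block [Read 0, Store 9 0, Add 9 9 16, Sub 10 5 9]) 4
      (\<lambda>R i out. I (Suc k) R i out \<and> (0 < R 10 \<longleftrightarrow> Suc k < 2 * n)) R i out"
    if "k < 2 * n" "I k R i out" for k R i out
  proof -
    have d: "drop k input = input ! k # drop (Suc k) input"
      using that(1) length_input by (simp add: Cons_nth_drop_Suc)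
    have "run_block [Read 0, Store 9 0, Add 9 9 16, Sub 10 5 9]
        (\<lambda>R i out. I (Suc k) R i out \<and> (0 < R 10 \<longleftrightarrow> Suc k < 2 * n)) R i out"
      using that d by (auto simp: I_def bases_def zero_from_def less_Suc_eq nat_add_distrib)
    then show ?thesis by (rule wp_Block) simp
  qed
  have "I 0 (R(9 := 20)) input []"
    using assms by (auto simp: I_def bases_def zero_from_def)
  then have "wp (DoWhile (Block [Read 0, Store 9 0, Add 9 9 16, Sub 10 5 9]) 10) (2 * n * Suc 4) (I (2 * n))
      (R(9 := 20)) input []"
    using assms(3) by (intro wp_DoWhile[where I = I] body) auto
  then have "wp read_input (1 + 2 * n * Suc 4) (I (2 * n)) R input []"
    unfolding read_input_def by (intro wp_Block_Seq) simp_all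
  then show ?thesis
    by (rule wp_mono) (auto simp: I_def has_input_def)
qed

text \<open>The frame condition outside the registers 12 to 14 lets the caller keep its arrays and
  its loop counter across the count.\<close>

lemma wp_count_lower:
  assumes "has_input R" "v < n" "R 11 = height v"
  shows "wp count_lower (2 + n * Suc (2 + (Suc 1 + 2)))
    (\<lambda>R' i' out'. R' 12 = int (rank v) \<and> (\<forall>a. a \<notin> {12, 13, 14} \<longrightarrow> R' a = R a) \<and> i' = i \<and> out' = out) R i out"
proof -
  define I where "I m R' i' out' \<longleftrightarrow> R' 12 = int (card {w. w < m \<and> height w \<le> height v}) \<and> R' 13 = 20 + int m \<and>
    (\<forall>a. a \<notin> {12, 13, 14} \<longrightarrow> R' a = R a) \<and> i' = i \<and> out' = out"
    for m and R' :: "nat \<Rightarrow> int" and i' out' :: "int list"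
  let ?body = "Block [Load 14 13, Sub 14 14 11] ;; Unless 14 (Block [Add 12 12 16]) ;;
       Block [Add 13 13 16, Sub 14 4 13]"
  have body: "wp ?body (2 + (Suc 1 + 2))
      (\<lambda>R i out. I (Suc m) R i out \<and> (0 < R 14 \<longleftrightarrow> Suc m < n)) R' i' out'"
    (is "wp _ _ ?Q R' i' out'")
    if "m < n" "I m R' i' out'" for m R' i' out'
  proof -
    have y: "R' (20 + m) = height m" and eqs: "R' 11 = height v" "R' 4 = 20 + int n" "R' 13 = 20 + int m"
      using that assms input_height by (auto simp: I_def has_input_def bases_def)
    define R1 where "R1 = R'(14 := height m - height v)"
    have "wp (Unless 14 (Block [Add 12 12 16]) ;; Block [Add 13 13 16, Sub 14 4 13]) (Suc 1 + 2) ?Q R1 i' out'"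
    proof (rule wp_Seq, rule wp_Unless)
      have fin: "wp (Block [Add 13 13 16, Sub 14 4 13]) 2 ?Q R2 i' out'"
        if "R2 = R1(12 := int (card {w. w < Suc m \<and> height w \<le> height v}))" for R2
      proof -
        have "run_block [Add 13 13 16, Sub 14 4 13] ?Q R2 i' out'"
          using \<open>m < n\<close> \<open>I m R' i' out'\<close> assms(1) that eqs
          by (auto simp: I_def R1_def has_input_def bases_def)
        then show ?thesis by (rule wp_Block) simp
      qed
      have R112: "R1 12 = int (card {w. w < m \<and> height w \<le> height v})" "R' 16 = 1"
        using \<open>I m R' i' out'\<close> assms(1) by (auto simp: I_def R1_def has_input_def bases_def)
      show "wp (Block [Add 13 13 16, Sub 14 4 13]) 2 ?Q R1 i' out'" if "0 < R1 14"
        using that R112 by (intro fin) (auto simp: R1_def card_less_Suc fun_eq_iff)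
      assume "R1 14 \<le> 0"
      then have "run_block [Add 12 12 16] (wp (Block [Add 13 13 16, Sub 14 4 13]) 2 ?Q) R1 i' out'"
        using R112 by (simp, intro fin) (auto simp: R1_def card_less_Suc fun_eq_iff)
      then show "wp (Block [Add 12 12 16]) 1 (wp (Block [Add 13 13 16, Sub 14 4 13]) 2 ?Q) R1 i' out'"
        by (rule wp_Block) simp
    qed
    then have "run_block [Load 14 13, Sub 14 14 11]
      (wp (Unless 14 (Block [Add 12 12 16]) ;; Block [Add 13 13 16, Sub 14 4 13]) (Suc 1 + 2) ?Q) R' i' out'"
      using y eqs by (simp add: R1_def nat_add_distrib)
    then show ?thesis by (rule wp_Block_Seq) simp
  qed
  have "I 0 (R(12 := 0, 13 := 20)) i out" by (auto simp: I_def)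
  then have "wp (DoWhile ?body 14) (n * Suc (2 + (Suc 1 + 2))) (I n) (R(12 := 0, 13 := 20)) i out"
    using assms(2) by (intro wp_DoWhile[where I = I] body) auto
  then have "wp count_lower (2 + n * Suc (2 + (Suc 1 + 2))) (I n) R i out"
    unfolding count_lower_def by (intro wp_Block_Seq) simp_all
  then show ?thesis
    by (rule wp_mono) (auto simp: I_def rank_def)
qed

text \<open>Each round contains a linear scan; this is one of the two phases with quadratic cost,
  the other being the assignment of tracks.\<close>

lemma wp_compute_ranks:
  assumes "has_input R" "zero_from (20 + 2 * n) R" "0 < n"
  shows "wp compute_ranks (1 + n * Suc (1 + ((2 + n * Suc (2 + (Suc 1 + 2))) + 5)))
    (\<lambda>R i' out'. has_ranks R \<and> zero_from (20 + 3 * n) R \<and> out' = out) R i out"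
proof -
  define I where "I v R' i' out' \<longleftrightarrow> has_input R' \<and> R' 9 = 20 + int v \<and>
    (\<forall>w<v. R' (20 + 2 * n + w) = int (rank w)) \<and> zero_from (20 + 2 * n + v) R' \<and> out' = out"
    for v and R' :: "nat \<Rightarrow> int" and i' out' :: "int list"
  let ?tail = "Block [Add 15 9 2, Add 15 15 2, Store 15 12, Add 9 9 16, Sub 14 4 9]"
  have body: "wp (Block [Load 11 9] ;; count_lower ;; ?tail) (1 + ((2 + n * Suc (2 + (Suc 1 + 2))) + 5))
      (\<lambda>R i out. I (Suc v) R i out \<and> (0 < R 14 \<longleftrightarrow> Suc v < n)) R' i' out'"
    (is "wp _ _ ?Q R' i' out'")
    if v: "v < n" "I v R' i' out'" for v R' i' out'
  proof -
    define R1 where "R1 = R'(11 := height v)"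
    have R1: "has_input R1" "R1 11 = height v" using v by (auto simp: R1_def I_def has_input_def bases_def)
    have "wp (count_lower ;; ?tail) ((2 + n * Suc (2 + (Suc 1 + 2))) + 5) ?Q R1 i' out'"
    proof (rule wp_SeqI[OF wp_count_lower[OF R1(1) v(1) R1(2)]], elim conjE)
      fix R2 i2 out2
      assume R2: "R2 12 = int (rank v)" "\<forall>a. a \<notin> {12, 13, 14} \<longrightarrow> R2 a = R1 a" "i2 = i'" "out2 = out'"
      have "I v R2 i2 out2"
        using v R2 by (auto simp: R1_def I_def has_input_def bases_def zero_from_def)
      then have "run_block [Add 15 9 2, Add 15 15 2, Store 15 12, Add 9 9 16, Sub 14 4 9] ?Q R2 i2 out2"
        using v(1) R2(1)
        by (auto simp: I_def has_input_def bases_def zero_from_def less_Suc_eq nat_add_distrib)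
      then show "wp ?tail 5 ?Q R2 i2 out2" by (rule wp_Block) simp
    qed
    then have "run_block [Load 11 9]
      (wp (count_lower ;; ?tail) ((2 + n * Suc (2 + (Suc 1 + 2))) + 5) ?Q) R' i' out'"
      using v input_height by (simp add: R1_def I_def has_input_def nat_add_distrib)
    then show ?thesis by (rule wp_Block_Seq) simp
  qed
  have "I 0 (R(9 := 20)) i out" using assms by (auto simp: I_def has_input_def bases_def zero_from_def)
  then have "wp (DoWhile (Block [Load 11 9] ;; count_lower ;; ?tail) 14)
      (n * Suc (1 + ((2 + n * Suc (2 + (Suc 1 + 2))) + 5))) (I n) (R(9 := 20)) i out"
    using assms(3) by (intro wp_DoWhile[where I = I] body) auto
  then have "wp compute_ranks (1 + n * Suc (1 + ((2 + n * Suc (2 + (Suc 1 + 2))) + 5))) (I n) R i out"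
    unfolding compute_ranks_def by (intro wp_Block_Seq) simp_all
  then show ?thesis
    by (rule wp_mono) (auto simp: I_def has_ranks_def zero_from_def)
qed

lemma nth_es:
  assumes "e < length es"
  shows "{fst (es ! e), snd (es ! e)} \<in> E"
    "fst (es ! e) < n" "snd (es ! e) < n"
proof -
  show "{fst (es ! e), snd (es ! e)} \<in> E" by (rule listed_edge) (simp add: assms)
  from edge_props[OF this] show "fst (es ! e) < n" "snd (es ! e) < n" by auto
qed

lemma nth_es_disjoint:
  assumes "d < length es" "e < length es" "d \<noteq> e"
  shows "{fst (es ! d), snd (es ! d)} \<inter> {fst (es ! e), snd (es ! e)} = {}"
proof -
  have "map (\<lambda>(u, v). {u, v}) es ! d \<noteq> map (\<lambda>(u, v). {u, v}) es ! e"
    using edges assms unfolding lists_edges_def by (metis length_map nth_eq_iff_index_eq)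
  then have "{fst (es ! d), snd (es ! d)} \<noteq> {fst (es ! e), snd (es ! e)}"
    using assms by (simp add: case_prod_beta)
  then show ?thesis using edge_unique[OF nth_es(1)[OF assms(1)] nth_es(1)[OF assms(2)]] by blast
qed

lemma has_ranks_edge:
  assumes "has_ranks R" "e < length es"
  defines "u \<equiv> fst (es ! e)" and "v \<equiv> snd (es ! e)"
  shows "R (20 + n + 2 * e) = int u" "R (21 + (n + 2 * e)) = int v"
    "R (u + 20) = height u" "R (v + 20) = height v"
    "R (u + (20 + 2 * n)) = int (rank u)" "R (v + (20 + 2 * n)) = int (rank v)"
    "u < n" "v < n"
proof -
  have e: "n + 2 * e < 2 * n" "Suc (n + 2 * e) < 2 * n" using assms(2) twice_length_es by auto
  show uv: "u < n" "v < n" unfolding u_def v_def using nth_es[OF assms(2)] by auto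
  have R: "\<And>i. i < 2 * n \<Longrightarrow> R (20 + i) = input ! i" using assms(1) by (auto simp: has_ranks_def has_input_def)
  show "R (20 + n + 2 * e) = int u" using R[OF e(1)] input_edge(1)[OF assms(2)] by (simp add: u_def add.assoc)
  show "R (21 + (n + 2 * e)) = int v" using R[OF e(2)] input_edge(2)[OF assms(2)] by (simp add: v_def add.assoc)
  show "R (u + 20) = height u" "R (v + 20) = height v" using R[of u] R[of v] uv input_height by (auto simp: add.commute)
  show "R (u + (20 + 2 * n)) = int (rank u)" "R (v + (20 + 2 * n)) = int (rank v)"
    using assms(1) uv by (auto simp: has_ranks_def add.commute)
qed

lemma has_ranks_update:
  assumes "has_ranks R" "9 \<le> a" "a \<noteq> 16" "a < 20 \<or> 20 + 3 * n \<le> a"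
  shows "has_ranks (R(a := x))"
  using assms by (auto simp: has_ranks_def has_input_def bases_def)

text \<open>Each round fills the entries of both end ranks. Distinct edges are disjoint, so nothing
  is overwritten, and since the matching is perfect every entry gets filled. The table is indexed
  from 1 and ends in cell \<open>20 + 4 * n\<close>, so untouched memory starts one cell
  later.\<close>

lemma wp_link_ranks:
  assumes "has_ranks R" "zero_from (20 + 3 * n) R" "0 < n"
  shows "wp link_ranks (1 + length es * Suc 13)
    (\<lambda>R i' out'. has_links R \<and> zero_from (21 + 4 * n) R \<and> out' = out) R i out"
proof -
  define I where "I e R' i' out' \<longleftrightarrow> has_ranks R' \<and> R' 9 = 20 + int n + 2 * int e \<and>
    (\<forall>d<e. R' (20 + 3 * n + rank (fst (es ! d))) = int (rank (snd (es ! d))) \<and>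
           R' (20 + 3 * n + rank (snd (es ! d))) = int (rank (fst (es ! d)))) \<and>
    zero_from (21 + 4 * n) R' \<and> out' = out"
    for e and R' :: "nat \<Rightarrow> int" and i' out' :: "int list"
  let ?is = "[Load 11 9, Add 11 11 5, Load 11 11, Add 9 9 16, Load 12 9, Add 12 12 5, Load 12 12,
       Add 13 11 6, Store 13 12, Add 13 12 6, Store 13 11, Add 9 9 16, Sub 14 5 9]"
  have body: "wp (Block ?is) 13
      (\<lambda>R i out. I (Suc e) R i out \<and> (0 < R 14 \<longleftrightarrow> Suc e < length es)) R' i' out'"
    (is "wp _ _ ?Q R' i' out'")
    if e: "e < length es" "I e R' i' out'" for e R' i' out'
  proof -
    define u v where "u = fst (es ! e)" and "v = snd (es ! e)"
    have hr: "has_ranks R'" and R9: "R' 9 = 20 + int n + 2 * int e" using e by (auto simp: I_def)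
    have b: "R' 16 = 1" "R' 5 = 20 + 2 * int n" "R' 6 = 20 + 3 * int n"
      using hr by (auto simp: has_ranks_def has_input_def bases_def)
    note edge = has_ranks_edge[OF hr e(1), folded u_def v_def]
    note ranks = rank_range[OF edge(7)] rank_range[OF edge(8)]
    define Rf where "Rf = R'(11 := int (rank u), 12 := int (rank v), 13 := 20 + 3 * int n + int (rank v),
      9 := 20 + int n + 2 * int (Suc e), 14 := int n - 2 * int (Suc e),
      20 + 3 * n + rank u := int (rank v), 20 + 3 * n + rank v := int (rank u))"
    have "I (Suc e) Rf i' out'"
    proof -
      have "has_ranks Rf" unfolding Rf_def by (intro has_ranks_update hr) auto
      moreover have "Rf (20 + 3 * n + rank (fst (es ! d))) = int (rank (snd (es ! d))) \<and>
           Rf (20 + 3 * n + rank (snd (es ! d))) = int (rank (fst (es ! d)))" if "d < Suc e" for d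
      proof (cases "d = e")
        case True
        have "rank u \<noteq> rank v" using rank_inj edge(7,8) edge_props(3)[OF nth_es(1)[OF e(1)]]
          unfolding u_def v_def by blast
        then show ?thesis unfolding True u_def[symmetric] v_def[symmetric] by (simp add: Rf_def)
      next
        case False
        then have d: "d < e" "d < length es" using that e by auto
        have "{fst (es ! d), snd (es ! d)} \<inter> {u, v} = {}"
          unfolding u_def v_def using nth_es_disjoint[OF d(2) e(1) False] .
        then have "rank (fst (es ! d)) \<noteq> rank u" "rank (fst (es ! d)) \<noteq> rank v"
          "rank (snd (es ! d)) \<noteq> rank u" "rank (snd (es ! d)) \<noteq> rank v"
          using rank_inj edge(7,8) nth_es(2,3)[OF d(2)] by blast+
        then show ?thesis using e(2) d(1) by (simp add: Rf_def I_def)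
      qed
      ultimately show ?thesis using e(2) ranks by (auto simp: I_def Rf_def zero_from_def)
    qed
    moreover have "0 < Rf 14 \<longleftrightarrow> Suc e < length es"
      using twice_length_es by (auto simp: Rf_def)
    moreover
    have "run_block ?is (\<lambda>R i out. R = Rf \<and> i = i' \<and> out = out') R' i' out'"
      by (simp add: R9 b edge nat_add_distrib nat_mult_distrib) (auto simp: Rf_def fun_eq_iff)
    then have "wp (Block ?is) 13 (\<lambda>R i out. R = Rf \<and> i = i' \<and> out = out') R' i' out'"
      by (rule wp_Block) simp
    ultimately show ?thesis by (auto elim!: wp_mono)
  qed
  have "I 0 (R(9 := 20 + int n)) i out"
    using assms by (auto simp: I_def has_ranks_def has_input_def bases_def zero_from_def)
  then have "wp (DoWhile (Block ?is) 14) (length es * Suc 13) (I (length es)) (R(9 := 20 + int n)) i out"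
    using assms(3) twice_length_es by (intro wp_DoWhile[where I = I] body) auto
  then have "wp link_ranks (1 + length es * Suc 13) (I (length es)) R i out"
    unfolding link_ranks_def using assms(1)
    by (intro wp_Block_Seq) (simp_all add: has_ranks_def has_input_def bases_def)
  then show ?thesis
  proof (rule wp_mono)
    fix R' i' out' assume I: "I (length es) R' i' out'"
    have "R' (20 + 3 * n + k) = int (opposite k)" if k: "k \<in> {1..n}" for k
    proof -
      obtain a b where ab: "(a, b) \<in> set es" "{vert k, vert (opposite k)} = {a, b}"
        using edge_listed[OF edge_at(1)[OF k]] by blast
      then obtain d where d: "d < length es" "es ! d = (a, b)" by (auto simp: in_set_conv_nth)
      have "R' (20 + 3 * n + rank a) = int (rank b)" "R' (20 + 3 * n + rank b) = int (rank a)"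
        using I d by (auto simp: I_def)
      moreover have "rank (vert k) = k" "rank (vert (opposite k)) = opposite k"
        using rank_vert k edge_at(2)[OF k] by auto
      ultimately show ?thesis using ab(2) by (auto simp: doubleton_eq_iff)
    qed
    then show "has_links R' \<and> zero_from (21 + 4 * n) R' \<and> out' = out"
      using I by (auto simp: I_def has_links_def)
  qed simp
qed

lemma has_links_update:
  assumes "has_links R" "9 \<le> a" "a \<noteq> 16" "a < 20 \<or> 20 + 4 * n < a"
  shows "has_links (R(a := x))"
proof -
  have "has_ranks (R(a := x))" using assms has_ranks_update[of R a x] by (auto simp: has_links_def)
  then show ?thesis using assms by (auto simp: has_links_def)
qed

text \<open>The second table can be described for all positive tracks because it is the last array
  in memory: tracks not yet used read as 0.\<close>

definition has_sweep :: "nat \<Rightarrow> (nat \<Rightarrow> int) \<Rightarrow> bool" where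
  "has_sweep k R \<longleftrightarrow> has_links R \<and>
     (\<forall>j\<in>{1..n}. R (j + (20 + 4 * n)) = int (fst (sweep opposite k) j)) \<and>
     (\<forall>c>0. R (c + (20 + 5 * n)) = int (snd (sweep opposite k) c))"

lemma has_sweep_update:
  assumes "has_sweep k R" "9 \<le> a" "a < 16"
  shows "has_sweep k (R(a := x))"
  using assms has_links_update[of R a x] by (auto simp: has_sweep_def)

lemma has_sweep_frame:
  assumes "has_sweep k R" "\<forall>a. a \<notin> {12, 13, 14} \<longrightarrow> R' a = R a"
  shows "has_sweep k R'"
proof -
  have "R' = R(12 := R' 12, 13 := R' 13, 14 := R' 14)" using assms(2) by (auto simp: fun_eq_iff)
  moreover have "has_sweep k (R(12 := R' 12, 13 := R' 13, 14 := R' 14))"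
    by (intro has_sweep_update assms(1)) auto
  ultimately show ?thesis by simp
qed

lemma wp_find_track:
  assumes "has_sweep k R" "R 9 = int (Suc k)" "k < n"
  defines "c \<equiv> LEAST c. 0 < c \<and> snd (sweep opposite k) c \<le> Suc k"
  shows "wp find_track (1 + n * Suc 4)
    (\<lambda>R' i' out'. R' 12 = int c \<and> R' 13 = int c + (20 + 5 * int n) \<and>
      (\<forall>a. a \<notin> {12, 13, 14} \<longrightarrow> R' a = R a) \<and> i' = i \<and> out' = out) R i out"
proof -
  have un: "snd (sweep opposite k) (Suc k) = 0" by (rule sweep_unused) simp
  then have ex: "0 < Suc k \<and> snd (sweep opposite k) (Suc k) \<le> Suc k" by simp
  have c: "0 < c" "snd (sweep opposite k) c \<le> Suc k"
    unfolding c_def using LeastI[of "\<lambda>c. 0 < c \<and> snd (sweep opposite k) c \<le> Suc k", OF ex] by auto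
  have cn: "c \<le> n" unfolding c_def using Least_le[of "\<lambda>c. 0 < c \<and> snd (sweep opposite k) c \<le> Suc k", OF ex] assms(3)
    by simp
  have cmin: "Suc k < snd (sweep opposite k) d" if "0 < d" "d < c" for d
    using not_less_Least[of d "\<lambda>c. 0 < c \<and> snd (sweep opposite k) c \<le> Suc k"] that unfolding c_def by auto
  \<comment> \<open>Register 13 receives its value inside the body, so it is described only after
    the first round.\<close>
  define I where "I m R' i' out' \<longleftrightarrow> R' 12 = int m \<and> (0 < m \<longrightarrow> R' 13 = int m + (20 + 5 * int n)) \<and>
    (\<forall>a. a \<notin> {12, 13, 14} \<longrightarrow> R' a = R a) \<and> i' = i \<and> out' = out"
    for m and R' :: "nat \<Rightarrow> int" and i' out' :: "int list"
  have b: "R 8 = 20 + 5 * int n" "R 16 = 1"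
    using assms(1) by (auto simp: has_sweep_def has_links_def has_ranks_def has_input_def bases_def)
  have body: "wp (Block [Add 12 12 16, Add 13 12 8, Load 14 13, Sub 14 14 9]) 4
      (\<lambda>R i out. I (Suc m) R i out \<and> (0 < R 14 \<longleftrightarrow> Suc m < c)) R' i' out'"
    if m: "m < c" "I m R' i' out'" for m R' i' out'
  proof -
    define M where "M = Suc m"
    have R': "R' 12 = int m" "R' 8 = 20 + 5 * int n" "R' 16 = 1" "R' 9 = int (Suc k)"
      using m b assms(2) by (auto simp: I_def)
    have T: "R' (M + (20 + 5 * n)) = int (snd (sweep opposite k) M)"
    proof -
      have "R' (M + (20 + 5 * n)) = R (M + (20 + 5 * n))" using m(2) unfolding I_def by auto
      moreover have "0 < M" by (simp add: M_def)
      ultimately show ?thesis using assms(1) unfolding has_sweep_def by simp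
    qed
    have IM: "int m + 1 = int M" by (simp add: M_def)
    have iff: "int (Suc k) < int (snd (sweep opposite k) M) \<longleftrightarrow> M < c"
    proof (cases "M < c")
      case True
      then show ?thesis using cmin[of M] by (simp add: M_def)
    next
      case False
      then have "M = c" using m(1) by (simp add: M_def)
      then show ?thesis using c(2) by simp
    qed
    have "run_block [Add 12 12 16, Add 13 12 8, Load 14 13, Sub 14 14 9]
        (\<lambda>R i out. I M R i out \<and> (0 < R 14 \<longleftrightarrow> M < c)) R' i' out'"
      using m(2) iff T by (simp add: R' IM nat_add_distrib nat_mult_distrib I_def del: of_nat_Suc)
    then show ?thesis unfolding M_def by (rule wp_Block) simp
  qed
  have "I 0 (R(12 := 0)) i out" by (auto simp: I_def)
  then have "wp (DoWhile (Block [Add 12 12 16, Add 13 12 8, Load 14 13, Sub 14 14 9]) 14) (c * Suc 4) (I c) (R(12 := 0)) i out"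
    using c(1) by (intro wp_DoWhile[where I = I] body) auto
  then have "wp find_track (1 + c * Suc 4) (I c) R i out"
    unfolding find_track_def by (intro wp_Block_Seq) simp_all
  then show ?thesis
    by (rule wp_mono) (use c(1) cn in \<open>auto simp: I_def\<close>)
qed

lemma has_sweep_track: "has_sweep n R \<Longrightarrow> has_tracks R"
  by (auto simp: has_sweep_def has_tracks_def has_links_def track_def add.commute)

lemma has_sweep_step:
  assumes "has_sweep k R" "k < n" and K: "K = Suc k" and q: "q = opposite K" and "Suc K < q"
    and c: "c = (LEAST c. 0 < c \<and> snd (sweep opposite k) c \<le> K)"
    and R': "\<And>a. R' a = (if a = q + (20 + 4 * n) \<or> a = K + (20 + 4 * n) then int c
       else if a = c + (20 + 5 * n) then int q else if a = 13 then x else R a)"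
  shows "has_sweep (Suc k) R'"
proof -
  have Kn: "K \<in> {1..n}" using assms by auto
  then have qn: "q \<in> {1..n}" using edge_at(2) q by simp
  \<comment> \<open>Positivity of \<open>c\<close> matters for the layout: an entry for track 0
    would share cell \<open>20 + 5 * n\<close> with position \<open>n\<close> of the first
    table.\<close>
  have "0 < Suc k \<and> snd (sweep opposite k) (Suc k) \<le> Suc k" using sweep_unused[of k "Suc k" opposite] by simp
  then have c0: "0 < c"
    unfolding c K by (rule LeastI[of "\<lambda>c. 0 < c \<and> snd (sweep opposite k) c \<le> Suc k", THEN conjunct1])
  obtain X T where XT: "sweep opposite k = (X, T)" by fastforce
  have s: "sweep opposite (Suc k) = (X(K := c, q := c), T(c := q))"
    using assms(5) by (simp add: XT c Let_def q K)
  have "R' = R(13 := x, c + (20 + 5 * n) := int q, K + (20 + 4 * n) := int c, q + (20 + 4 * n) := int c)"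
    using Kn qn c0 by (auto simp: fun_eq_iff R')
  moreover have "has_links (R(13 := x, c + (20 + 5 * n) := int q, K + (20 + 4 * n) := int c, q + (20 + 4 * n) := int c))"
    using Kn qn c0 assms(1) by (intro has_links_update) (auto simp: has_sweep_def)
  ultimately have "has_links R'" by simp
  moreover have "R' (j + (20 + 4 * n)) = int ((X(K := c, q := c)) j)" if "j \<in> {1..n}" for j
    using assms(1) that Kn qn c0 by (auto simp: R' has_sweep_def XT)
  moreover have "R' (d + (20 + 5 * n)) = int ((T(c := q)) d)" if "0 < d" for d
    using assms(1) that Kn qn c0 by (auto simp: R' has_sweep_def XT)
  ultimately show ?thesis unfolding has_sweep_def s by simp
qed

lemma wp_assign_tracks:
  assumes "has_links R" "zero_from (21 + 4 * n) R" "0 < n"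
  shows "wp assign_tracks (1 + n * Suc (5 + (Suc ((1 + n * Suc 4) + 5) + 3)))
    (\<lambda>R i' out'. has_tracks R \<and> out' = out) R i out"
proof -
  define I where "I k R' i' out' \<longleftrightarrow> has_sweep k R' \<and> R' 9 = int (Suc k) \<and> out' = out"
    for k and R' :: "nat \<Rightarrow> int" and i' out' :: "int list"
  let ?is = "[Store 13 11, Add 13 9 7, Store 13 12, Add 13 11 7, Store 13 12]"
  let ?tail = "Block [Add 9 9 16, Sub 14 2 9, Add 14 14 16]"
  let ?alloc = "Unless 12 (find_track ;; Block ?is)"
  let ?body = "Block [Add 11 9 6, Load 11 11, Sub 12 9 11, Add 12 12 16, Add 12 12 16] ;; ?alloc ;; ?tail"
  have body: "wp ?body (5 + (Suc ((1 + n * Suc 4) + 5) + 3))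
      (\<lambda>R i out. I (Suc k) R i out \<and> (0 < R 14 \<longleftrightarrow> Suc k < n)) R' i' out'"
    (is "wp _ _ ?Q R' i' out'")
    if k: "k < n" "I k R' i' out'" for k R' i' out'
  proof -
    define K where "K = Suc k"
    define q where "q = opposite K"
    have Kn: "K \<in> {1..n}" using k by (simp add: K_def)
    have hs: "has_sweep k R'" and R9: "R' 9 = int K" and o: "out' = out" using k by (auto simp: I_def K_def)
    have b: "R' 6 = 20 + 3 * int n" "R' 16 = 1" "R' (K + (20 + 3 * n)) = int q"
      using hs Kn by (auto simp: has_sweep_def has_links_def has_ranks_def has_input_def bases_def q_def add.commute)
    define R1 where "R1 = R'(11 := int q, 12 := 2 + (int K - int q))"
    have hs1: "has_sweep k R1" unfolding R1_def by (intro has_sweep_update hs) auto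
    have R1_9: "R1 9 = int K" by (simp add: R1_def R9)
    have tail: "wp ?tail 3 ?Q R2 i2 out2"
      if "has_sweep (Suc k) R2 \<and> R2 9 = int K \<and> out2 = out" for R2 i2 out2
    proof -
      have b2: "R2 2 = int n" "R2 16 = 1"
        using that by (auto simp: has_sweep_def has_links_def has_ranks_def has_input_def bases_def)
      have "has_sweep (Suc k) (R2(9 := int K + 1, 14 := int n - int K))"
        using that by (intro has_sweep_update) auto
      then have "run_block [Add 9 9 16, Sub 14 2 9, Add 14 14 16] ?Q R2 i2 out2"
        using that b2 by (simp add: I_def) (auto simp: K_def)
      then show ?thesis by (rule wp_Block) simp
    qed
    have "wp (?alloc ;; ?tail) (Suc ((1 + n * Suc 4) + 5) + 3) ?Q R1 i' out'"
    proof (rule wp_SeqI[OF wp_Unless tail])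
      show "has_sweep (Suc k) R1 \<and> R1 9 = int K \<and> out' = out" if "0 < R1 12"
      proof -
        \<comment> \<open>Register 12 holds \<open>2 + (K - q)\<close>, so skipping the allocation
          agrees with \<open>sweep\<close> leaving its state unchanged.\<close>
        have "\<not> Suc K < q" using that by (simp add: R1_def)
        then have "sweep opposite (Suc k) = sweep opposite k"
          by (simp add: q_def K_def Let_def case_prod_beta)
        then show ?thesis using hs1 R1_9 o by (simp add: has_sweep_def)
      qed
    next
      assume "R1 12 \<le> 0"
      then have long: "Suc K < q" by (simp add: R1_def)
      define c where "c = (LEAST c. 0 < c \<and> snd (sweep opposite k) c \<le> K)"
      have f: "wp find_track (1 + n * Suc 4)
        (\<lambda>R2 i2 out2. R2 12 = int c \<and> R2 13 = int c + (20 + 5 * int n) \<and>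
          (\<forall>a. a \<notin> {12, 13, 14} \<longrightarrow> R2 a = R1 a) \<and> i2 = i' \<and> out2 = out') R1 i' out'"
        using wp_find_track[OF hs1 R1_9[unfolded K_def] k(1)] unfolding c_def K_def .
      show "wp (find_track ;; Block ?is) ((1 + n * Suc 4) + 5)
        (\<lambda>R2 i2 out2. has_sweep (Suc k) R2 \<and> R2 9 = int K \<and> out2 = out) R1 i' out'"
      proof (rule wp_SeqI[OF f], elim conjE)
        fix R2 :: "nat \<Rightarrow> int" and i2 out2
        assume R2: "R2 12 = int c" "R2 13 = int c + (20 + 5 * int n)"
          "\<forall>a. a \<notin> {12, 13, 14} \<longrightarrow> R2 a = R1 a" "i2 = i'" "out2 = out'"
        have hs2: "has_sweep k R2" using has_sweep_frame[OF hs1 R2(3)] .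
        have b2: "R2 11 = int q" "R2 9 = int K" "R2 7 = 20 + 4 * int n"
          using hs2 R2(3) R1_9
          by (auto simp: R1_def has_sweep_def has_links_def has_ranks_def has_input_def bases_def)
        define R3 where "R3 a = (if a = q + (20 + 4 * n) \<or> a = K + (20 + 4 * n) then int c
          else if a = c + (20 + 5 * n) then int q else if a = 13 then int q + (20 + 4 * int n) else R2 a)" for a
        have "has_sweep (Suc k) R3"
          by (rule has_sweep_step[OF hs2 k(1) K_def q_def long c_def R3_def])
        moreover have "R3 9 = int K" using b2 by (simp add: R3_def)
        moreover have "run_block ?is (\<lambda>R i out. R = R3 \<and> out = out') R2 i2 out2"
          using R2(4,5) by (simp add: R2(1,2) b2 nat_add_distrib nat_mult_distrib) (auto simp: R3_def fun_eq_iff)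
        then have "wp (Block ?is) 5 (\<lambda>R i out. R = R3 \<and> out = out') R2 i2 out2"
          by (rule wp_Block) simp
        ultimately show "wp (Block ?is) 5 (\<lambda>R2 i2 out2. has_sweep (Suc k) R2 \<and> R2 9 = int K \<and> out2 = out) R2 i2 out2"
          using o by (auto elim!: wp_mono)
      qed
    qed
    then have "run_block [Add 11 9 6, Load 11 11, Sub 12 9 11, Add 12 12 16, Add 12 12 16]
        (wp (?alloc ;; ?tail) (Suc ((1 + n * Suc 4) + 5) + 3) ?Q) R' i' out'"
      by (simp add: R9 b nat_add_distrib nat_mult_distrib R1_def)
    then show ?thesis by (rule wp_Block_Seq) simp
  qed
  \<comment> \<open>The zeros above the partner table represent
    \<open>sweep opposite 0\<close>.\<close>
  have "I 0 (R(9 := 1)) i out"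
    using has_links_update[OF assms(1), of 9 1] assms(2) by (auto simp: I_def has_sweep_def zero_from_def)
  then have "wp (DoWhile ?body 14) (n * Suc (5 + (Suc ((1 + n * Suc 4) + 5) + 3))) (I n) (R(9 := 1)) i out"
    using assms(3) by (intro wp_DoWhile[where I = I] body) auto
  then have "wp assign_tracks (1 + n * Suc (5 + (Suc ((1 + n * Suc 4) + 5) + 3))) (I n) R i out"
    unfolding assign_tracks_def by (intro wp_Block_Seq) simp_all
  then show ?thesis
    by (rule wp_mono) (auto simp: I_def has_sweep_track)
qed

lemma encode_chain_chain:
  "encode_chain (chain x (of_int a) (of_int b)) =
     (if x = 0 then [2, 0, a, 0, b] else [4, 0, a, int x, a, int x, b, 0, b])"
  by (simp add: encode_chain_def chain_def)

lemma wp_print_drawing: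
  assumes "has_tracks R" "0 < n"
  shows "wp print_drawing (1 + length es * Suc (13 + (Suc 6 + (Suc 10 + 2))))
    (\<lambda>_ _ out. out = encode_drawing drawing es) R i []"
proof -
  define I where "I e R' i' out' \<longleftrightarrow> has_tracks R' \<and> R' 9 = 20 + int n + 2 * int e \<and>
    out' = encode_drawing drawing (take e es)"
    for e and R' :: "nat \<Rightarrow> int" and i' out' :: "int list"
  let ?is = "[Load 10 9, Add 11 10 3, Load 11 11, Add 12 10 5, Load 12 12, Add 12 12 7, Load 12 12,
         Add 9 9 16, Load 10 9, Add 13 10 3, Load 13 13, Const 10 0, Sub 15 16 12]"
  let ?short = "[Const 14 2, Print 14, Print 10, Print 11, Print 10, Print 13]"
  let ?long = "[Const 14 4, Print 14, Print 10, Print 11, Print 12, Print 11,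
         Print 12, Print 13, Print 10, Print 13]"
  let ?tail = "[Add 9 9 16, Sub 14 5 9]"
  have body: "wp (Block ?is ;; Unless 12 (Block ?short) ;; Unless 15 (Block ?long) ;; Block ?tail)
      (13 + (Suc 6 + (Suc 10 + 2)))
      (\<lambda>R i out. I (Suc e) R i out \<and> (0 < R 14 \<longleftrightarrow> Suc e < length es)) R' i' out'"
    (is "wp _ _ ?Q R' i' out'")
    if e: "e < length es" "I e R' i' out'" for e R' i' out'
  proof -
    define u v where "u = fst (es ! e)" and "v = snd (es ! e)"
    have ht: "has_tracks R'" and hr: "has_ranks R'" and R9: "R' 9 = 20 + int n + 2 * int e"
      and out': "out' = encode_drawing drawing (take e es)" using e by (auto simp: I_def has_tracks_def)
    have b: "R' 16 = 1" "R' 3 = 20" "R' 5 = 20 + 2 * int n" "R' 7 = 20 + 4 * int n"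
      using hr by (auto simp: has_ranks_def has_input_def bases_def)
    note edge = has_ranks_edge[OF hr e(1), folded u_def v_def]
    define x where "x = track (rank u)"
    have X: "R' (rank u + (20 + 4 * n)) = int x"
      using ht rank_range[OF edge(7)] by (auto simp: has_tracks_def x_def add.commute)
    define ys where "ys = (if x = 0 then [2, 0, height u, 0, height v]
      else [4, 0, height u, int x, height u, int x, height v, 0, height v])"
    have uv: "es ! e = (u, v)" by (simp add: u_def v_def)
    then have "(u, v) \<in> set es" using e(1) by (metis nth_mem)
    then have "encode_chain (drawing {u, v}) = ys"
      by (simp add: drawing_eq encode_chain_chain x_def ys_def)
    then have out: "encode_drawing drawing (take (Suc e) es) = out' @ ys"
      using e(1) uv by (simp add: take_Suc_conv_app_nth encode_drawing_def out')
    define R1 where "R1 = R'(11 := height u, 12 := int x, 9 := 21 + int n + 2 * int e, 10 := 0,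
      13 := height v, 15 := 1 - int x)"
    have tail: "wp (Block ?tail) 2 ?Q R2 i2 out2" if R2_out2: "(\<exists>y. R2 = R1(14 := y)) \<and> out2 = out' @ ys" for R2 i2 out2
    proof -
      obtain y where R2: "R2 = R1(14 := y)" using R2_out2 by blast
      have "has_tracks (R'(a := z))" if "has_tracks R'" "9 \<le> a" "a < 16" for R' a z
        using that has_ranks_update[of R' a z] by (auto simp: has_tracks_def)
      then have "has_tracks (R2(9 := 22 + int n + 2 * int e, 14 := int n - 2 - 2 * int e))"
        unfolding R2 R1_def using ht by simp
      moreover have "R2 9 = 21 + int n + 2 * int e" "R2 5 = 20 + 2 * int n" "R2 16 = 1"
        using b by (simp_all add: R2 R1_def)
      moreover have "2 * int (length es) = int n" using twice_length_es by linarith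
      ultimately have "run_block ?tail ?Q R2 i2 out2"
        using R2_out2 out by (simp add: I_def algebra_simps) linarith
      then show ?thesis by (rule wp_Block) simp
    qed
    \<comment> \<open>Between the two conditional blocks the chain has been printed precisely if it
      lies on the axis; scratch register 14 may have changed.\<close>
    define mid :: assertion where "mid = (\<lambda>R2 i2 out2. (\<exists>y. R2 = R1(14 := y)) \<and> out2 = (if x = 0 then out' @ ys else out'))"
    have long: "wp (Unless 15 (Block ?long) ;; Block ?tail) (Suc 10 + 2) ?Q R2 i2 out2" if m: "mid R2 i2 out2" for R2 i2 out2
    proof (rule wp_SeqI[OF wp_Unless tail])
      obtain y where R2: "R2 = R1(14 := y)" and out2: "out2 = (if x = 0 then out' @ ys else out')"
        using m by (auto simp: mid_def)
      show "(\<exists>y. R2 = R1(14 := y)) \<and> out2 = out' @ ys" if "0 < R2 15"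
        using that R2 out2 by (auto simp: R1_def)
      assume "R2 15 \<le> 0"
      then have x: "x \<noteq> 0" by (simp add: R2 R1_def)
      then have "run_block ?long (\<lambda>R3 i3 out3. (\<exists>y. R3 = R1(14 := y)) \<and> out3 = out' @ ys) R2 i2 out2"
        by (simp add: R2 out2 ys_def) (auto simp: R1_def)
      then show "wp (Block ?long) 10 (\<lambda>R3 i3 out3. (\<exists>y. R3 = R1(14 := y)) \<and> out3 = out' @ ys) R2 i2 out2"
        by (rule wp_Block) simp
    qed
    have print: "wp (Unless 12 (Block ?short) ;; Unless 15 (Block ?long) ;; Block ?tail) (Suc 6 + (Suc 10 + 2)) ?Q R1 i' out'"
    proof (rule wp_SeqI[OF wp_Unless long])
      show "mid R1 i' out'" if "0 < R1 12"
        using that by (auto simp: mid_def R1_def fun_eq_iff)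
      assume "R1 12 \<le> 0"
      then have x: "x = 0" by (simp add: R1_def)
      then have "run_block ?short mid R1 i' out'"
        by (simp add: mid_def ys_def) (auto simp: R1_def)
      then show "wp (Block ?short) 6 mid R1 i' out'" by (rule wp_Block) simp
    qed
    have "run_block ?is (\<lambda>R i out. R = R1 \<and> i = i' \<and> out = out') R' i' out'"
      by (simp add: R9 b edge X nat_add_distrib nat_mult_distrib) (auto simp: R1_def fun_eq_iff)
    then have "wp (Block ?is) 13 (\<lambda>R i out. R = R1 \<and> i = i' \<and> out = out') R' i' out'"
      by (rule wp_Block) simp
    then show ?thesis by (rule wp_SeqI) (elim conjE, hypsubst, rule print)
  qed
  have "I 0 (R(9 := 20 + int n)) i []"
    using assms has_ranks_update[of R 9 "20 + int n"] by (auto simp: I_def has_tracks_def encode_drawing_def)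
  then have "wp (DoWhile (Block ?is ;; Unless 12 (Block ?short) ;; Unless 15 (Block ?long) ;; Block ?tail) 14)
      (length es * Suc (13 + (Suc 6 + (Suc 10 + 2)))) (I (length es)) (R(9 := 20 + int n)) i []"
    using assms(2) twice_length_es by (intro wp_DoWhile[where I = I] body) auto
  then have "wp print_drawing (1 + length es * Suc (13 + (Suc 6 + (Suc 10 + 2)))) (I (length es)) R i []"
    unfolding print_drawing_def using assms(1)
    by (intro wp_Block_Seq) (simp_all add: has_tracks_def has_ranks_def has_input_def bases_def)
  then show ?thesis
    by (rule wp_mono) (auto simp: I_def)
qed

text \<open>With \<open>2 * length es = n\<close> the budgets sum to
  \<open>12 * n ^ 2 + 59 * n + 15\<close>; the stated bound is a round number above this.\<close>

lemma wp_program: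
  "wp program (100 * n ^ 2 + 100 * n + 100) (\<lambda>_ _ out. out = encode_drawing drawing es)
     (\<lambda>_. 0) (encode_instance n \<mu> es) []"
proof -
  define R1 :: "nat \<Rightarrow> int" where "R1 = (\<lambda>_. 0)(2 := int n, 16 := 1, 0 := 1 - int n)"
  let ?main = "set_up ;; read_input ;; compute_ranks ;; link_ranks ;; assign_tracks ;; print_drawing"
  let ?\<Phi> = "\<lambda>_ _ out. out = encode_drawing drawing es"
  define T1 where "T1 = 1 + 2 * n * Suc 4"
  define T2 where "T2 = 1 + n * Suc (1 + ((2 + n * Suc (2 + (Suc 1 + 2))) + 5))"
  define T3 where "T3 = 1 + length es * Suc 13"
  define T4 where "T4 = 1 + n * Suc (5 + (Suc ((1 + n * Suc 4) + 5) + 3))"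
  define T5 where "T5 = 1 + length es * Suc (13 + (Suc 6 + (Suc 10 + 2)))"
  define T where "T = 6 + (T1 + (T2 + (T3 + (T4 + T5))))"
  have "wp (Unless 0 ?main) (Suc T) ?\<Phi> R1 input []"
  proof (rule wp_Unless)
    \<comment> \<open>This is the empty instance: nothing is printed, and there is no edge to
      encode.\<close>
    assume "0 < R1 0"
    then have "es = []" using twice_length_es by (simp add: R1_def)
    then show "[] = encode_drawing drawing es" by (simp add: encode_drawing_def)
  next
    assume "R1 0 \<le> 0"
    then have n: "0 < n" by (simp add: R1_def)
    define R2 where "R2 = R1(3 := 20, 4 := 20 + int n, 5 := 20 + 2 * int n, 6 := 20 + 3 * int n,
      7 := 20 + 4 * int n, 8 := 20 + 5 * int n)"
    have R2: "bases R2" "zero_from 20 R2" by (auto simp: R2_def R1_def bases_def zero_from_def)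
    have "run_block [Const 3 20, Add 4 3 2, Add 5 4 2, Add 6 5 2, Add 7 6 2, Add 8 7 2]
      (\<lambda>R i out. R = R2 \<and> i = input \<and> out = []) R1 input []"
      by (simp add: R2_def R1_def add.commute)
    then have set_up: "wp set_up 6 (\<lambda>R i out. R = R2 \<and> i = input \<and> out = []) R1 input []"
      unfolding set_up_def by (rule wp_Block) simp
    have run5: "wp print_drawing T5 ?\<Phi> R i []" if "has_tracks R" for R i
      unfolding T5_def by (rule wp_print_drawing[OF that n])
    have run4: "wp (assign_tracks ;; print_drawing) (T4 + T5) ?\<Phi> R i []"
      if "has_links R" "zero_from (21 + 4 * n) R" for R i
      unfolding T4_def by (rule wp_SeqI[OF wp_assign_tracks[OF that n]]) (use run5 in blast)
    have run3: "wp (link_ranks ;; assign_tracks ;; print_drawing) (T3 + (T4 + T5)) ?\<Phi> R i []"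
      if "has_ranks R" "zero_from (20 + 3 * n) R" for R i
      unfolding T3_def by (rule wp_SeqI[OF wp_link_ranks[OF that n]]) (use run4 in blast)
    have run2: "wp (compute_ranks ;; link_ranks ;; assign_tracks ;; print_drawing)
        (T2 + (T3 + (T4 + T5))) ?\<Phi> R i []"
      if "has_input R" "zero_from (20 + 2 * n) R" for R i
      unfolding T2_def by (rule wp_SeqI[OF wp_compute_ranks[OF that n]]) (use run3 in blast)
    have run1: "wp (read_input ;; compute_ranks ;; link_ranks ;; assign_tracks ;; print_drawing)
        (T1 + (T2 + (T3 + (T4 + T5)))) ?\<Phi> R2 input []"
      unfolding T1_def by (rule wp_SeqI[OF wp_read_input[OF R2 n]]) (use run2 in blast)
    show "wp ?main T ?\<Phi> R1 input []"
      unfolding T_def by (rule wp_SeqI[OF set_up]) (use run1 in blast)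
  qed
  then have "run_block [Read 2, Const 16 1, Sub 0 16 2]
      (wp (Unless 0 ?main) (Suc T) ?\<Phi>) (\<lambda>_. 0) (int n # input) []"
    by (simp add: R1_def)
  then have "wp program (3 + Suc T) ?\<Phi> (\<lambda>_. 0) (int n # input) []"
    unfolding program_def by (rule wp_Block_Seq) simp
  moreover have "3 + Suc T \<le> 100 * n ^ 2 + 100 * n + 100"
    unfolding T_def T1_def T2_def T3_def T4_def T5_def using twice_length_es by (simp add: algebra_simps power2_eq_square)
  ultimately show ?thesis unfolding encode_instance_eq by (rule wp_mono)
qed

end

text \<open>Program and time bound are fixed before the instance, whereas the drawing may depend on
  the list \<open>es\<close>; this permits the witness \<open>drawing\<close>, whose chains follow
  the listed directions.\<close>

theorem theorem5:
  "\<exists>(P :: instr list) (T :: nat \<Rightarrow> nat).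
     (\<lambda>n. real (T n)) \<in> O(\<lambda>n. real n ^ 2) \<and>
     (\<forall>(n :: nat) (S :: point set) (E :: nat set set) (\<mu> :: nat \<Rightarrow> point) (es :: (nat \<times> nat) list).
        finite S \<and> card S = n \<and> (\<forall>p\<in>S. fst p = 0 \<and> integer_point p) \<and>
        perfect_matching {..<n} E \<and> bij_betw \<mu> {..<n} S \<and> lists_edges es E \<longrightarrow>
        (\<exists>D. min_area_right_RAC2_drawing {..<n} E \<mu> D \<and>
             computes_within P (encode_instance n \<mu> es) (encode_drawing D es) (T n)))"
proof (intro exI[of _ "compile 0 program"] exI[of _ "\<lambda>n. 100 * n ^ 2 + 100 * n + 100"] conjI allI impI)
  show "(\<lambda>n. real (100 * n ^ 2 + 100 * n + 100)) \<in> O(\<lambda>n. real n ^ 2)"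
  \<comment> \<open>For \<open>n \<ge> 1\<close> each of the three terms is at most
    \<open>100 * n ^ 2\<close>.\<close>
  proof (rule landau_o.bigI[of 300])
    show "\<forall>\<^sub>F n in sequentially. norm (real (100 * n ^ 2 + 100 * n + 100)) \<le> 300 * norm (real n ^ 2)"
    proof (rule eventually_sequentiallyI[of 1])
      fix n :: nat assume "1 \<le> n"
      then have "n \<le> n ^ 2" "1 \<le> n ^ 2" by (simp_all add: power2_eq_square)
      then have "100 * n ^ 2 + 100 * n + 100 \<le> 300 * n ^ 2" by linarith
      then have "real (100 * n ^ 2 + 100 * n + 100) \<le> real (300 * n ^ 2)" by (rule of_nat_mono)
      then show "norm (real (100 * n ^ 2 + 100 * n + 100)) \<le> 300 * norm (real n ^ 2)" by simp
    qed
  qed simp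
next
  fix n S E \<mu> es
  assume *: "finite S \<and> card S = n \<and> (\<forall>p\<in>S. fst p = 0 \<and> integer_point p) \<and>
    perfect_matching {..<n} E \<and> bij_betw \<mu> {..<n} S \<and> lists_edges es E"
  then interpret matching_instance n S E \<mu> es by unfold_locales auto
  show "\<exists>D. min_area_right_RAC2_drawing {..<n} E \<mu> D \<and>
    computes_within (compile 0 program) (encode_instance n \<mu> es) (encode_drawing D es) (100 * n ^ 2 + 100 * n + 100)"
    using drawing_optimal wp_computes_within[OF wp_program] by blast
qed

end
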